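(* For any $p\in[1,2]$, $d,\Delta\in\mathbb{N}$ and $\varepsilon\in(0,1)$ there exists an insertion-only randomized streaming algorithm (with access to a random oracle $\mathbf{r}$) with the following guarantees: (Maintenance) it implicitly maintains a set of distinct points $X=\{x_1,\dots,x_n\}\subset[\Delta]^d$ using $\mathrm{poly}(d\log\Delta/\varepsilon)$ words of space; (Updates) for $x\in[\Delta]^d$, a subroutine $\textsc{Add-Point}(x)$ updates the state so that it maintains $X\cup\{x\}$; (Query) for $x\in[\Delta]^d$, a subroutine $\textsc{Assign}(x)$ outputs $(1,0)$ or $(0,1)$. For any set $X=\{x_1,\dots,x_n\}\subset[\Delta]^d$ (indexed in insertion order), if $\textsc{Add-Point}(x_i)$ is executed for all $i\in[n]$ in order and then $\mathbf{z}_i\leftarrow\textsc{Assign}(x_i)$ for all $i$, then $$\mathbb{E}[f(\mathbf{z})]\le\min_{\substack{z\in\{0,1\}^{n\times\{0,1\}}\\ z_i\neq(0,0)}}f(z)+\varepsilon\sum_{i=1}^n\sum_{j=1}^n\|x_i-x_j\|_p.$$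
   Context: Cuts are encoded as $z\in\{0,1\}^{n\times\{0,1\}}$ with rows $z_i\in\{(1,0),(0,1),(0,0)\}$ ($(1,0)$: 0-side, $(0,1)$: 1-side, $(0,0)$: unassigned), and $f(z)=\frac12\sum_{i,j}\|x_i-x_j\|_p(z_{i,0}z_{j,0}+z_{i,1}z_{j,1})$. Insertion-only streaming model: the distinct points of $X\subset[\Delta]^d$ arrive one at a time in arbitrary order; the algorithm maintains a memory of words of $\Theta(\log(nd\Delta/\varepsilon))$ bits, updated upon each insertion; after all insertions it answers queries. Random oracle model: the algorithm has query access to a function $\mathbf{r}:\{0,1\}^*\to\{0,1\}$ returning an independent uniformly random bit for each string, which is not counted in the space. *)

theory Defs
  imports "HOL-Probability.Probability" "HOL-Computational_Algebra.Polynomial"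
begin

definition lp_norm :: "real \<Rightarrow> nat \<Rightarrow> (nat \<Rightarrow> real) \<Rightarrow> real" where
  "lp_norm p d v = (\<Sum>k<d. \<bar>v k\<bar> powr p) powr (1 / p)"

type_synonym point = "nat \<Rightarrow> nat"

definition grid :: "nat \<Rightarrow> nat \<Rightarrow> point set" where
  "grid d \<Delta> = {..<d} \<rightarrow>\<^sub>E {1..\<Delta>}"

definition lp_dist :: "real \<Rightarrow> nat \<Rightarrow> point \<Rightarrow> point \<Rightarrow> real" where
  "lp_dist p d x y = lp_norm p d (\<lambda>k. real (x k) - real (y k))"


text \<open>The components of a row are \<open>fst (z i)\<close> for \<open>z\<^sub>i\<^sub>,\<^sub>0\<close> and \<open>snd (z i)\<close> for \<open>z\<^sub>i\<^sub>,\<^sub>1\<close>;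
  points and rows are indexed from \<open>0\<close>.\<close>

type_synonym row = "nat \<times> nat"

definition cuts :: "nat \<Rightarrow> (nat \<Rightarrow> row) set" where
  "cuts n = {..<n} \<rightarrow>\<^sub>E {(1, 0), (0, 1), (0, 0)}"

definition cut_cost :: "real \<Rightarrow> nat \<Rightarrow> point list \<Rightarrow> (nat \<Rightarrow> row) \<Rightarrow> real" where
  "cut_cost p d xs z =
     1 / 2 * (\<Sum>i<length xs. \<Sum>j<length xs. lp_dist p d (xs ! i) (xs ! j) *
       real (fst (z i) * fst (z j) + snd (z i) * snd (z j)))"


text \<open>A computation with query access to a random bit function is a well-founded adaptive query tree, so each
  run asks finitely many queries, and the outcome depends on that function through the answers only.\<close>

type_synonym bit_oracle = "bool list \<Rightarrow> bool"

datatype 'a oracle_comp = Return 'a | Query "bool list" "bool \<Rightarrow> 'a oracle_comp"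

primrec run :: "bit_oracle \<Rightarrow> 'a oracle_comp \<Rightarrow> 'a" where
  "run r (Return a) = a"
| "run r (Query s c) = run r (c (r s))"

definition random_oracle :: "bit_oracle measure" where
  "random_oracle = (\<Pi>\<^sub>M s \<in> UNIV. measure_pmf (pmf_of_set UNIV))"


text \<open>The memory is a list of words; a word of \<open>b\<close> bits is a natural number below \<open>2 ^ b\<close>.\<close>

type_synonym memory = "nat list"

record stream_alg =
  init :: memory
  add_point :: "point \<Rightarrow> memory \<Rightarrow> memory oracle_comp"
  assign :: "point \<Rightarrow> memory \<Rightarrow> row oracle_comp"

definition memory_after :: "stream_alg \<Rightarrow> bit_oracle \<Rightarrow> point list \<Rightarrow> memory" where
  "memory_after A r xs = fold (\<lambda>x m. run r (add_point A x m)) xs (init A)"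

definition assigned :: "stream_alg \<Rightarrow> bit_oracle \<Rightarrow> point list \<Rightarrow> point \<Rightarrow> row" where
  "assigned A r xs x = run r (assign A x (memory_after A r xs))"

definition fits_in :: "memory \<Rightarrow> real \<Rightarrow> nat \<Rightarrow> bool" where
  "fits_in m S b \<longleftrightarrow> real (length m) \<le> S \<and> (\<forall>w\<in>set m. w < 2 ^ b)"

text \<open>Words of \<open>\<Theta>(log (n d \<Delta> / \<epsilon>))\<close> bits, where \<open>c > 0\<close> is the hidden constant. For \<open>n, d, \<Delta> \<ge> 1\<close>
  and \<open>\<epsilon> < 1\<close> the logarithm is positive, and rounding up leaves at least one bit.\<close>

definition word_bits :: "real \<Rightarrow> nat \<Rightarrow> nat \<Rightarrow> nat \<Rightarrow> real \<Rightarrow> nat" where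
  "word_bits c n d \<Delta> \<epsilon> = nat \<lceil>c * log 2 (real n * real d * real \<Delta> / \<epsilon>)\<rceil>"


text \<open>All quantities below are random variables, so that Bochner integrals of bounded functions of
  them are genuine expectations.\<close>

lemma prob_space_random_oracle: "prob_space random_oracle"
  unfolding random_oracle_def by (intro prob_space_PiM prob_space_measure_pmf)

lemma measurable_run [measurable]:
  "(\<lambda>r. run r t) \<in> random_oracle \<rightarrow>\<^sub>M count_space UNIV"
proof (induction t)
  case (Query s c)
  have 1: "(\<lambda>r. r s) \<in> random_oracle \<rightarrow>\<^sub>M count_space (UNIV :: bool set)"
  proof -
    let ?M = "measure_pmf (pmf_of_set (UNIV :: bool set))"
    have "(\<lambda>r. r s) \<in> random_oracle \<rightarrow>\<^sub>M ?M"
      unfolding random_oracle_def by (rule measurable_component_singleton) simp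
    moreover have "sets ?M = sets (count_space UNIV)"
      by simp
    ultimately show ?thesis
      using measurable_cong_sets by blast
  qed
  have "(\<lambda>r. run r (c (r s))) \<in> random_oracle \<rightarrow>\<^sub>M count_space UNIV"
    using measurable_compose_countable[of "\<lambda>b r. run r (c b)", OF _ 1] Query by auto
  then show ?case by simp
qed simp

lemma measurable_memory_after [measurable]:
  "(\<lambda>r. memory_after A r xs) \<in> random_oracle \<rightarrow>\<^sub>M count_space UNIV"
proof (induction xs rule: rev_induct)
  case (snoc x xs)
  show ?case
    using measurable_compose_countable[of "\<lambda>m r. run r (add_point A x m)", OF measurable_run snoc]
    by (simp add: memory_after_def)
qed (simp add: memory_after_def)

lemma measurable_assigned [measurable]:
  "(\<lambda>r. assigned A r xs x) \<in> random_oracle \<rightarrow>\<^sub>M count_space UNIV"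
  using measurable_compose_countable[of "\<lambda>m r. run r (assign A x m)", OF measurable_run
      measurable_memory_after]
  by (simp add: assigned_def)

lemma borel_measurable_cut_cost_assigned:
  "(\<lambda>r. cut_cost p d xs (\<lambda>i. assigned A r xs (xs ! i))) \<in> borel_measurable random_oracle"
proof -
  have "(\<lambda>r. real (g (assigned A r xs (xs ! i)))) \<in> borel_measurable random_oracle" for i and g :: "row \<Rightarrow> nat"
    by (rule measurable_compose[OF measurable_assigned]) simp
  from this[of fst] this[of snd] show ?thesis
    unfolding cut_cost_def of_nat_add of_nat_mult by measurable
qed

end

theory Submission
  imports Defs
begin

text \<open>
  The algorithm is deterministic. With \<open>E = \<lceil>d log \<Delta> / \<epsilon>\<rceil>\<close> the grid has at most \<open>2 ^ E\<close> points, and one word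
  holds at least one bit, so it is enough to keep a state from a set of size \<open>2 ^ poly E\<close>.

  \<^item> \<^emph>\<open>Sparsification.\<close> Sampling the points of a weighted set proportionally to their 1-median
    sensitivities yields polynomially many weighted points which preserve, for all \<open>y\<close> and all \<open>A\<close> in a family
    of \<open>2 ^ poly E\<close> sets, the sum of the distances from \<open>y\<close> to the points in \<open>A\<close>, up to a small fraction of
    the sum of the distances from \<open>y\<close> to all points.
  \<^item> \<^emph>\<open>A small class of cuts.\<close> Hash the points into \<open>O(E)\<close> blocks and, starting from an optimal cut, move
    one block after the other to the side that is better with respect to the current cut. The second order
    error is the total distance inside the blocks. Deciding with a sparsified copy of the current cut costs
    little, hence some near-optimal cut is described by the hash function and one sparse set per block.
    There are only \<open>2 ^ poly E\<close> such descriptions.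
  \<^item> \<^emph>\<open>Merge and reduce.\<close> For the family of the sides of these cuts, the sparsification guarantee is linear
    in the weighted set, so it can be maintained in a binary counter. It determines the cost of every cut of
    the class up to a small error, and a query answers with the cheapest cut on the summary.
\<close>

section \<open>Derandomised sampling\<close>

text \<open>For negative \<open>x\<close>, put \<open>y = - x\<close> and invert the Taylor lower
  bound of \<open>exp y\<close>: its product with \<open>1 - y + y^2\<close> is at least
  \<open>1\<close>.\<close>

lemma exp_le_quadratic:
  fixes x :: real
  assumes "\<bar>x\<bar> \<le> 1"
  shows "exp x \<le> 1 + x + x\<^sup>2"
proof (cases "x \<ge> 0")
  case True
  then show ?thesis using exp_bound[of x] assms by auto
next
  case False
  define y where "y = - x"
  have y: "0 \<le> y" "y \<le> 1" using False assms by (auto simp: y_def)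
  have "1 + y + y\<^sup>2 / 2 \<le> exp y" using exp_lower_Taylor_quadratic[of y] y by simp
  moreover have "1 \<le> (1 - y + y\<^sup>2) * (1 + y + y\<^sup>2 / 2)"
  proof -
    have "(1 - y + y\<^sup>2) * (1 + y + y\<^sup>2 / 2) = 1 + (y\<^sup>2 + y ^ 3 + y ^ 4) / 2"
      by (simp add: field_simps power2_eq_square power3_eq_cube power4_eq_xxxx)
    then show ?thesis using y by simp
  qed
  moreover have "0 \<le> 1 - y + y\<^sup>2" using y by simp
  ultimately have "1 \<le> (1 - y + y\<^sup>2) * exp y"
    by (meson mult_left_mono order_trans)
  then have "exp (- y) \<le> 1 - y + y\<^sup>2"
    by (simp add: exp_minus field_simps)
  then show ?thesis by (simp add: y_def)
qed

text \<open>The linear term of the quadratic bound averages to zero because \<open>Y\<close> is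
  centred. This is the moment bound behind Hoeffding's inequality.\<close>

lemma exp_moment_le:
  fixes p Y :: "'b \<Rightarrow> real"
  assumes "\<And>j. j \<in> J \<Longrightarrow> 0 \<le> p j" "sum p J = 1"
    and "\<And>j. j \<in> J \<Longrightarrow> \<bar>Y j\<bar> \<le> 1" "(\<Sum>j\<in>J. p j * Y j) = 0" "\<bar>l\<bar> \<le> 1"
  shows "(\<Sum>j\<in>J. p j * exp (l * Y j)) \<le> exp (l\<^sup>2)"
proof -
  have "p j * exp (l * Y j) \<le> p j * (1 + l * Y j + l\<^sup>2)" if "j \<in> J" for j
  proof (rule mult_left_mono)
    have "\<bar>l * Y j\<bar> \<le> 1 * 1" unfolding abs_mult using assms that by (intro mult_mono) auto
    then have "exp (l * Y j) \<le> 1 + l * Y j + (l * Y j)\<^sup>2" by (intro exp_le_quadratic) simp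
    also have "(l * Y j)\<^sup>2 \<le> l\<^sup>2 * 1"
      unfolding power_mult_distrib using assms(3)[OF that] by (intro mult_left_mono) (auto simp: abs_square_le_1)
    finally show "exp (l * Y j) \<le> 1 + l * Y j + l\<^sup>2" by simp
  qed (use assms that in auto)
  then have "(\<Sum>j\<in>J. p j * exp (l * Y j)) \<le> (\<Sum>j\<in>J. p j * (1 + l * Y j + l\<^sup>2))"
    by (rule sum_mono)
  also have "\<dots> = (1 + l\<^sup>2) * sum p J + l * (\<Sum>j\<in>J. p j * Y j)"
    by (simp add: sum_distrib_left sum_distrib_right sum.distrib algebra_simps)
  also have "\<dots> = 1 + l\<^sup>2" using assms by simp
  also have "\<dots> \<le> exp (l\<^sup>2)" by simp
  finally show ?thesis .
qed

text \<open>The sample is built greedily: averaging over the next element, the two-sided exponential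
  potential of the deviations grows by a factor of at most \<open>exp (l\<^sup>2)\<close>.\<close>

lemma exists_sample_low_potential:
  fixes p :: "'b \<Rightarrow> real" and Y :: "'i \<Rightarrow> 'b \<Rightarrow> real"
  assumes "finite J" "\<And>j. j \<in> J \<Longrightarrow> 0 \<le> p j" "sum p J = 1"
    and Y: "\<And>i j. i \<in> I \<Longrightarrow> j \<in> J \<Longrightarrow> \<bar>Y i j\<bar> \<le> 1"
    and mean: "\<And>i. i \<in> I \<Longrightarrow> (\<Sum>j\<in>J. p j * Y i j) = 0" and l: "\<bar>l\<bar> \<le> 1"
  shows "\<exists>js. length js = k \<and> set js \<subseteq> {j\<in>J. 0 < p j} \<and>
    (\<Sum>i\<in>I. exp (l * (\<Sum>j\<leftarrow>js. Y i j)) + exp (- l * (\<Sum>j\<leftarrow>js. Y i j))) \<le> 2 * card I * exp (k * l\<^sup>2)"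
proof (induction k)
  case (Suc k)
  then obtain js where js: "length js = k" "set js \<subseteq> {j\<in>J. 0 < p j}"
    and pot: "(\<Sum>i\<in>I. exp (l * (\<Sum>j\<leftarrow>js. Y i j)) + exp (- l * (\<Sum>j\<leftarrow>js. Y i j))) \<le> 2 * card I * exp (k * l\<^sup>2)"
    by blast
  define a where "a i = exp (l * (\<Sum>j\<leftarrow>js. Y i j))" for i
  define b where "b i = exp (- l * (\<Sum>j\<leftarrow>js. Y i j))" for i
  define \<Phi> where "\<Phi> j = (\<Sum>i\<in>I. a i * exp (l * Y i j) + b i * exp (- l * Y i j))" for j
  define B where "B = 2 * card I * exp (Suc k * l\<^sup>2)"
  have "(\<Sum>j\<in>J. p j * \<Phi> j) = (\<Sum>i\<in>I. a i * (\<Sum>j\<in>J. p j * exp (l * Y i j)) + b i * (\<Sum>j\<in>J. p j * exp (- l * Y i j)))"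
    unfolding \<Phi>_def sum_distrib_left sum.distrib[symmetric]
    by (subst sum.swap) (simp add: algebra_simps)
  also have "\<dots> \<le> (\<Sum>i\<in>I. a i * exp (l\<^sup>2) + b i * exp (l\<^sup>2))"
  proof (rule sum_mono)
    fix i assume i: "i \<in> I"
    have "(\<Sum>j\<in>J. p j * exp (l * Y i j)) \<le> exp (l\<^sup>2)"
      using assms i by (intro exp_moment_le) auto
    moreover have "(\<Sum>j\<in>J. p j * exp (- l * Y i j)) \<le> exp ((- l)\<^sup>2)"
      using assms i by (intro exp_moment_le) auto
    ultimately show "a i * (\<Sum>j\<in>J. p j * exp (l * Y i j)) + b i * (\<Sum>j\<in>J. p j * exp (- l * Y i j))
      \<le> a i * exp (l\<^sup>2) + b i * exp (l\<^sup>2)"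
      by (intro add_mono mult_left_mono) (auto simp: a_def b_def)
  qed
  also have "\<dots> = (\<Sum>i\<in>I. a i + b i) * exp (l\<^sup>2)"
    by (simp only: distrib_right[symmetric] sum_distrib_right)
  also have "\<dots> \<le> (2 * card I * exp (k * l\<^sup>2)) * exp (l\<^sup>2)"
    using pot by (intro mult_right_mono) (auto simp: a_def b_def)
  also have "\<dots> = B" by (simp add: B_def exp_add[symmetric] algebra_simps)
  finally have avg: "(\<Sum>j\<in>J. p j * \<Phi> j) \<le> B" .
  have "\<exists>j\<in>J. 0 < p j \<and> \<Phi> j \<le> B"
  proof (rule ccontr)
    assume neg: "\<not> ?thesis"
    have "\<exists>j\<in>J. 0 < p j"
    proof (rule ccontr)
      assume "\<not> ?thesis"
      then have "sum p J = 0" using assms(2) by (intro sum.neutral) (auto simp: not_less intro: antisym)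
      then show False using assms by simp
    qed
    then have "(\<Sum>j\<in>J. p j * B) < (\<Sum>j\<in>J. p j * \<Phi> j)"
    proof (intro sum_strict_mono_ex1)
      show "\<forall>j\<in>J. p j * B \<le> p j * \<Phi> j"
        using neg assms(2) by (metis mult_le_cancel_left not_le less_eq_real_def mult_zero_left)
      assume "\<exists>j\<in>J. 0 < p j"
      then show "\<exists>j\<in>J. p j * B < p j * \<Phi> j"
        using neg by (metis mult_strict_left_mono not_le)
    qed (use assms in auto)
    also have "(\<Sum>j\<in>J. p j * B) = B" using assms(3) by (simp add: sum_distrib_right[symmetric])
    finally show False using avg by simp
  qed
  then obtain j where j: "j \<in> J" "0 < p j" "\<Phi> j \<le> B" by blast
  have "(\<Sum>i\<in>I. exp (l * (\<Sum>j\<leftarrow>j # js. Y i j)) + exp (- l * (\<Sum>j\<leftarrow>j # js. Y i j))) = \<Phi> j"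
    by (simp add: \<Phi>_def a_def b_def exp_add[symmetric] algebra_simps)
  then show ?case
    using j js by (intro exI[of _ "j # js"]) (auto simp: B_def)
qed (auto intro: exI[of _ "[]"])

text \<open>A Chernoff and union bound in deterministic form. The choice
  \<open>l = 1 / (2 e)\<close> gives \<open>m l^2 = q + 1\<close> and
  \<open>l m / e = 2 (q + 1)\<close>, so the final potential is at most
  \<open>exp (l m / e)\<close>; its terms are positive, hence no deviation exceeds
  \<open>m / e\<close>.\<close>

lemma exists_sample:
  fixes p :: "'b \<Rightarrow> real" and f :: "'i \<Rightarrow> 'b \<Rightarrow> real" and e q :: nat
  defines "m \<equiv> 4 * (q + 1) * e\<^sup>2"
  assumes "finite J" "\<And>j. j \<in> J \<Longrightarrow> 0 \<le> p j" "sum p J = 1" "finite I" "card I \<le> 2 ^ q" "1 \<le> e"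
    and f: "\<And>i j. i \<in> I \<Longrightarrow> j \<in> J \<Longrightarrow> 0 \<le> f i j \<and> f i j \<le> 1"
  shows "\<exists>js. length js = m \<and> set js \<subseteq> {j\<in>J. 0 < p j} \<and>
    (\<forall>i\<in>I. \<bar>(\<Sum>j\<leftarrow>js. f i j) - m * (\<Sum>j\<in>J. p j * f i j)\<bar> \<le> m / e)"
proof -
  define \<mu> where "\<mu> i = (\<Sum>j\<in>J. p j * f i j)" for i
  define l where "l = 1 / (2 * real e)"
  have mu: "0 \<le> \<mu> i" "\<mu> i \<le> 1" if "i \<in> I" for i
  proof -
    show "0 \<le> \<mu> i" unfolding \<mu>_def using f that assms by (intro sum_nonneg mult_nonneg_nonneg) auto
    have "\<mu> i \<le> (\<Sum>j\<in>J. p j * 1)" unfolding \<mu>_def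
      using f that assms by (intro sum_mono mult_left_mono) auto
    then show "\<mu> i \<le> 1" using assms by simp
  qed
  have e: "real e \<ge> 1" using assms by simp
  have "\<exists>js. length js = m \<and> set js \<subseteq> {j\<in>J. 0 < p j} \<and>
    (\<Sum>i\<in>I. exp (l * (\<Sum>j\<leftarrow>js. f i j - \<mu> i)) + exp (- l * (\<Sum>j\<leftarrow>js. f i j - \<mu> i))) \<le> 2 * card I * exp (m * l\<^sup>2)"
  proof (rule exists_sample_low_potential)
    show "\<bar>f i j - \<mu> i\<bar> \<le> 1" if "i \<in> I" "j \<in> J" for i j
      using f[OF that] mu[OF that(1)] by auto
    show "(\<Sum>j\<in>J. p j * (f i j - \<mu> i)) = 0" if "i \<in> I" for i
      using assms(4) by (simp add: right_diff_distrib sum_subtractf sum_distrib_right[symmetric] \<mu>_def)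
    show "\<bar>l\<bar> \<le> 1" using e by (simp add: l_def)
  qed (use assms in auto)
  then obtain js where js: "length js = m" "set js \<subseteq> {j\<in>J. 0 < p j}"
    and pot: "(\<Sum>i\<in>I. exp (l * (\<Sum>j\<leftarrow>js. f i j - \<mu> i)) + exp (- l * (\<Sum>j\<leftarrow>js. f i j - \<mu> i))) \<le> 2 * card I * exp (m * l\<^sup>2)"
    by blast
  have ml: "m * l\<^sup>2 = q + 1" using e by (simp add: l_def m_def power2_eq_square field_simps)
  have ml2: "l * (m / e) = 2 * (real q + 1)" using e by (simp add: l_def m_def power2_eq_square field_simps)
  have small: "2 * real (card I) * exp (m * l\<^sup>2) \<le> exp (2 * (real q + 1))"
  proof -
    have "2 * real (card I) \<le> 2 ^ (q + 1)" using of_nat_mono[OF assms(6), where 'a=real] by simp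
    also have "\<dots> \<le> exp 1 ^ (q + 1)" using exp_ge_add_one_self[of 1] by (intro power_mono) auto
    also have "\<dots> = exp (real q + 1)" by (simp add: exp_of_nat_mult[symmetric] exp_add)
    finally have "2 * real (card I) * exp (m * l\<^sup>2) \<le> exp (real q + 1) * exp (real q + 1)"
      unfolding ml by (intro mult_mono) auto
    then show ?thesis by (simp add: exp_add[symmetric])
  qed
  have "\<bar>(\<Sum>j\<leftarrow>js. f i j) - m * \<mu> i\<bar> \<le> m / e" if i: "i \<in> I" for i
  proof -
    define D where "D = (\<Sum>j\<leftarrow>js. f i j) - m * \<mu> i"
    have D: "(\<Sum>j\<leftarrow>js. f i j - \<mu> i) = D"
      using js(1) by (simp add: D_def sum_list_subtractf sum_list_triv)
    have "exp (l * D) + exp (- l * D) \<le> (\<Sum>i\<in>I. exp (l * (\<Sum>j\<leftarrow>js. f i j - \<mu> i)) + exp (- l * (\<Sum>j\<leftarrow>js. f i j - \<mu> i)))"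
      using member_le_sum[OF i, of "\<lambda>i. exp (l * (\<Sum>j\<leftarrow>js. f i j - \<mu> i)) + exp (- l * (\<Sum>j\<leftarrow>js. f i j - \<mu> i))"] assms(5)
      by (simp add: D)
    then have *: "exp (l * D) + exp (- l * D) \<le> exp (l * (m / e))" using pot small ml2 by simp
    have "exp (l * D) \<le> exp (l * (m / e))" "exp (- l * D) \<le> exp (l * (m / e))"
      using * exp_gt_zero[of "l * D"] exp_gt_zero[of "- l * D"] by linarith+
    then have "l * D \<le> l * (m / e)" "l * (- D) \<le> l * (m / e)" unfolding exp_le_cancel_iff by simp_all
    moreover have "l > 0" using e by (simp add: l_def)
    ultimately have "D \<le> m / e" "- D \<le> m / e" by (metis mult_le_cancel_left_pos)+
    then show ?thesis by (simp add: D_def)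
  qed
  then show ?thesis using js unfolding \<mu>_def by blast
qed

section \<open>Sparsification by sensitivity sampling\<close>

text \<open>A pseudometric on the whole type, with \<open>G\<close> as the finite set of admissible
  points. The intended \<open>lp_dist\<close> ignores coordinates from \<open>d\<close> on, so
  distinct functions can be at distance \<open>0\<close>.\<close>

locale finite_metric =
  fixes G :: "'a set" and \<delta> :: "'a \<Rightarrow> 'a \<Rightarrow> real"
  assumes finite_points: "finite G"
    and dist_nonneg: "0 \<le> \<delta> x y"
    and dist_self: "\<delta> x x = 0"
    and dist_sym: "\<delta> x y = \<delta> y x"
    and dist_triangle: "\<delta> x z \<le> \<delta> x y + \<delta> y z"
begin

text \<open>A list of weighted points is read as a discrete measure. With the full set in place of
  \<open>A\<close> this is the 1-median cost of the centre \<open>y\<close>.\<close>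

definition pull :: "('a \<times> real) list \<Rightarrow> ('a \<Rightarrow> bool) \<Rightarrow> 'a \<Rightarrow> real" where
  "pull c A y = (\<Sum>(x, v)\<leftarrow>c. if A x then v * \<delta> x y else 0)"

definition mass :: "('a \<times> real) list \<Rightarrow> real" where
  "mass c = (\<Sum>(x, v)\<leftarrow>c. v)"

lemma pull_simps [simp]:
  "pull [] A y = 0"
  "pull (a # c) A y = (if A (fst a) then snd a * \<delta> (fst a) y else 0) + pull c A y"
  "pull (c @ c') A y = pull c A y + pull c' A y"
  by (auto simp: pull_def split: prod.splits)

lemma mass_simps [simp]:
  "mass [] = 0" "mass (a # c) = snd a + mass c" "mass (c @ c') = mass c + mass c'"
  by (auto simp: mass_def split: prod.splits)

lemma pull_nonneg: "\<forall>(x, v)\<in>set c. 0 \<le> v \<Longrightarrow> 0 \<le> pull c A y"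
  by (induction c) (auto simp: dist_nonneg)

lemma pull_conv_sum:
  "pull c A y = (\<Sum>j<length c. if A (fst (c ! j)) then snd (c ! j) * \<delta> (fst (c ! j)) y else 0)"
  by (simp add: pull_def sum_list_sum_nth atLeast0LessThan split_beta)

lemma mass_conv_sum: "mass c = (\<Sum>j<length c. snd (c ! j))"
  by (simp add: mass_def sum_list_sum_nth atLeast0LessThan split_beta)

text \<open>The sensitivities are \<open>s x = \<delta> x x\<^sub>0 / F x\<^sub>0 + 2 / M\<close>, where \<open>x\<^sub>0\<close> is a weighted 1-median of \<open>c\<close>. If \<open>c\<close> sits on top of its median, the
  first summand of \<open>s\<close> is \<open>0\<close> by the convention on division by \<open>0\<close>, as it should be.\<close>

lemma exists_sensitivity:
  assumes c: "c \<noteq> []" "\<forall>(x, v)\<in>set c. x \<in> G \<and> 0 < v"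
  shows "\<exists>s. (\<forall>x. 2 / mass c \<le> s x) \<and> (\<Sum>(x, v)\<leftarrow>c. v * s x) \<le> 3 \<and>
    (\<forall>(x, v)\<in>set c. \<forall>y\<in>G. \<delta> x y \<le> s x * pull c (\<lambda>_. True) y)"
proof -
  define F where "F = pull c (\<lambda>_. True)"
  define M where "M = mass c"
  have M: "M > 0" using c unfolding M_def
  proof (induction c rule: list_nonempty_induct)
    case (cons a c)
    then show ?case by (cases a) auto
  qed auto
  have Gne: "G \<noteq> {}" using c by (cases c) auto
  define x0 where "x0 = arg_min_on F G"
  have x0: "x0 \<in> G" "\<And>y. y \<in> G \<Longrightarrow> F x0 \<le> F y"
    using arg_min_if_finite[OF finite_points Gne, of F] by (auto simp: x0_def not_less[symmetric])
  define s where "s x = \<delta> x x0 / F x0 + 2 / M" for x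
  have F0: "F y \<ge> 0" for y unfolding F_def by (rule pull_nonneg) (use c in auto)
  have "2 / M \<le> s x" for x using F0[of x0] by (simp add: s_def dist_nonneg)
  moreover have "(\<Sum>(x, v)\<leftarrow>c. v * s x) \<le> 3"
  proof -
    have "(\<Sum>(x, v)\<leftarrow>c'. v * s x) = pull c' (\<lambda>_. True) x0 / F x0 + 2 * mass c' / M" for c'
      by (induction c') (auto simp: s_def add_divide_distrib algebra_simps)
    then have "(\<Sum>(x, v)\<leftarrow>c. v * s x) = F x0 / F x0 + 2 * M / M" by (simp add: F_def M_def)
    also have "\<dots> \<le> 3" using M by simp
    finally show ?thesis .
  qed
  moreover have "\<delta> x y \<le> s x * F y" if xv: "(x, v) \<in> set c" and y: "y \<in> G" for x v y
  proof -
    \<comment> \<open>The triangle inequality is summed over the weighted points; optimality of the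
      median then replaces \<open>F x0\<close> by \<open>F y\<close>.\<close>
    have "M * \<delta> x0 y \<le> F x0 + F y"
    proof -
      have "mass c' * \<delta> x0 y \<le> pull c' (\<lambda>_. True) x0 + pull c' (\<lambda>_. True) y"
        if "\<forall>(x, v)\<in>set c'. 0 < v" for c' :: "('a \<times> real) list"
        using that
      proof (induction c')
        case (Cons a c')
        have "snd a * \<delta> x0 y \<le> snd a * (\<delta> (fst a) x0 + \<delta> (fst a) y)"
          using Cons dist_triangle[of x0 y "fst a"] dist_sym[of x0 "fst a"] by (intro mult_left_mono) auto
        then show ?case using Cons by (auto simp: algebra_simps)
      qed auto
      then show ?thesis using c unfolding F_def M_def by auto
    qed
    then have 1: "\<delta> x0 y \<le> 2 / M * F y" using M x0(2)[OF y] by (simp add: field_simps)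
    have 2: "\<delta> x x0 \<le> \<delta> x x0 / F x0 * F y"
    proof (cases "F x0 = 0")
      case True
      have "v * \<delta> x x0 \<le> F x0"
      proof -
        have "v * \<delta> x x0 \<le> pull c' (\<lambda>_. True) x0"
          if "\<forall>(x, v)\<in>set c'. 0 < v" "(x, v) \<in> set c'" for c'
          using that
        proof (induction c')
          case (Cons a c')
          then have "0 \<le> pull c' (\<lambda>_. True) x0" by (intro pull_nonneg) auto
          moreover have "0 \<le> snd a * \<delta> (fst a) x0" using Cons dist_nonneg by auto
          ultimately show ?case using Cons by auto
        qed auto
        then show ?thesis using c xv unfolding F_def by auto
      qed
      then have "\<delta> x x0 \<le> 0" using True c xv by (auto simp: mult_le_0_iff)
      then show ?thesis using True by simp
    next
      case False
      then have "F x0 > 0" using F0[of x0] by simp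
      then show ?thesis using x0(2)[OF y] dist_nonneg[of x x0] by (simp add: pos_le_divide_eq mult_left_mono)
    qed
    show ?thesis using 1 2 dist_triangle[of x y x0] by (simp add: s_def algebra_simps)
  qed
  ultimately show ?thesis unfolding F_def M_def by (intro exI[of _ s]) auto
qed

text \<open>Importance sampling: draw \<open>m\<close> indices with probabilities proportional to
  weight times sensitivity, give every draw the weight \<open>u j\<close> that makes the estimate
  unbiased, and round down to multiples of \<tau> / \<open>N\<close>. Sampling to accuracy
  \<open>7 * e\<close> explains \<open>196 = 4 * 7^2\<close> and costs 3/7 of the allowed error;
  rounding costs the other 4/7.\<close>

lemma exists_sparse_weights:
  fixes e q :: nat and \<tau> :: real and \<A> :: "('a \<Rightarrow> bool) set"
  defines "m \<equiv> 196 * (q + 1) * e\<^sup>2"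
  defines "N \<equiv> 7 * e * m"
  assumes c: "\<forall>(x, v)\<in>set c. x \<in> G \<and> \<tau> \<le> v" and "0 < \<tau>"
    and "finite \<A>" "card \<A> * card G \<le> 2 ^ q" "1 \<le> e"
  shows "\<exists>c'. length c' \<le> m \<and> (\<forall>(x, v)\<in>set c'. x \<in> G \<and> (\<exists>n\<ge>1. v = real n * (\<tau> / N)))
    \<and> mass c' \<le> 2 * mass c
    \<and> (\<forall>A\<in>\<A>. \<forall>y\<in>G. \<bar>pull c' A y - pull c A y\<bar> \<le> pull c (\<lambda>_. True) y / e)"
proof (cases "c = []")
  case True
  then show ?thesis by (intro exI[of _ "[]"]) auto
next
  case False
  have "0 < m" using \<open>1 \<le> e\<close> by (simp add: m_def)
  then have "0 < N" using \<open>1 \<le> e\<close> by (simp add: N_def)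
  define F where "F = pull c (\<lambda>_. True)"
  define J where "J = {..<length c}"
  define X where "X j = fst (c ! j)" for j
  define v where "v j = snd (c ! j)" for j
  have X: "X j \<in> G" "\<tau> \<le> v j" "0 < v j" "(X j, v j) \<in> set c" if "j \<in> J" for j
  proof -
    show *: "(X j, v j) \<in> set c" using that by (simp add: X_def v_def J_def)
    show "X j \<in> G" "\<tau> \<le> v j" "0 < v j" using bspec[OF c *] \<open>0 < \<tau>\<close> by auto
  qed
  obtain s where s: "\<And>x. 2 / mass c \<le> s x" "(\<Sum>(x, v)\<leftarrow>c. v * s x) \<le> 3"
    "\<And>x v y. (x, v) \<in> set c \<Longrightarrow> y \<in> G \<Longrightarrow> \<delta> x y \<le> s x * F y"
  proof -
    have "\<forall>(x, v)\<in>set c. x \<in> G \<and> 0 < v" using c \<open>0 < \<tau>\<close> by auto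
    then show ?thesis using exists_sensitivity[of c] False that unfolding F_def by blast
  qed
  define S where "S = (\<Sum>j\<in>J. v j * s (X j))"
  have S3: "S \<le> 3" using s(2) by (simp add: S_def J_def X_def v_def sum_list_sum_nth atLeast0LessThan split_beta)
  have M: "mass c = (\<Sum>j\<in>J. v j)" by (simp add: mass_conv_sum J_def v_def)
  have "J \<noteq> {}" "finite J" using False by (auto simp: J_def)
  then have Mpos: "mass c > 0" unfolding M using X by (intro sum_pos) auto
  have spos: "s x > 0" for x using s(1)[of x] Mpos by (meson divide_pos_pos less_le_trans zero_less_numeral)
  have Spos: "S > 0" unfolding S_def using \<open>J \<noteq> {}\<close> \<open>finite J\<close> X spos by (intro sum_pos) auto
  have F0: "F y \<ge> 0" for y unfolding F_def by (rule pull_nonneg) (use c \<open>0 < \<tau>\<close> in auto)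
  define p where "p j = v j * s (X j) / S" for j
  \<comment> \<open>Dividing by the sensitivity bound brings the values into the unit interval. If
    \<open>F y\<close> is \<open>0\<close>, the quotient is \<open>0\<close>, in agreement with the
    vanishing distance.\<close>
  define f where "f = (\<lambda>(A, y) j. if A (X j) then \<delta> (X j) y / (s (X j) * F y) else 0)"
  have f01: "0 \<le> f i j \<and> f i j \<le> 1" if ij: "i \<in> \<A> \<times> G" "j \<in> J" for i j
  proof -
    obtain A y where i: "i = (A, y)" "y \<in> G" using ij by auto
    have "0 \<le> s (X j) * F y" using spos[of "X j"] F0[of y] by simp
    moreover have "a / b \<le> 1" if "0 \<le> b" "a \<le> b" for a b :: real
      using that by (cases "b = 0") (auto simp: divide_le_eq_1)
    ultimately show ?thesis using s(3)[OF X(4)[OF ij(2)] i(2)] dist_nonneg[of "X j" y]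
      by (auto simp: f_def i)
  qed
  have ff: "\<delta> (X j) y = s (X j) * F y * (\<delta> (X j) y / (s (X j) * F y))" if "j \<in> J" "y \<in> G" for j y
    using s(3)[OF X(4)[OF that(1)] that(2)] dist_nonneg[of "X j" y] spos[of "X j"] by (cases "F y = 0") auto
  have "\<exists>js. length js = 4 * (q + 1) * (7 * e)\<^sup>2 \<and> set js \<subseteq> {j\<in>J. 0 < p j} \<and>
    (\<forall>i\<in>\<A> \<times> G. \<bar>(\<Sum>j\<leftarrow>js. f i j) - real (4 * (q + 1) * (7 * e)\<^sup>2) * (\<Sum>j\<in>J. p j * f i j)\<bar> \<le> real (4 * (q + 1) * (7 * e)\<^sup>2) / real (7 * e))"
  proof (rule exists_sample)
    show "0 \<le> p j" if "j \<in> J" for j using X[OF that] spos[of "X j"] Spos by (simp add: p_def)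
    show "sum p J = 1" using Spos by (simp add: p_def sum_divide_distrib[symmetric] S_def)
  qed (use f01 assms finite_points \<open>finite J\<close> in \<open>auto simp: card_cartesian_product\<close>)
  moreover have m_eq: "4 * (q + 1) * (7 * e)\<^sup>2 = m" by (simp add: m_def power_mult_distrib)
  ultimately obtain js where js: "length js = m" "set js \<subseteq> {j\<in>J. 0 < p j}"
    and "\<forall>i\<in>\<A> \<times> G. \<bar>(\<Sum>j\<leftarrow>js. f i j) - real m * (\<Sum>j\<in>J. p j * f i j)\<bar> \<le> real m / real (7 * e)"
    unfolding m_eq by blast
  then have dev: "\<bar>(\<Sum>j\<leftarrow>js. f (A, y) j) - m * (\<Sum>j\<in>J. p j * f (A, y) j)\<bar> \<le> m / (7 * e)"
    if "A \<in> \<A>" "y \<in> G" for A y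
    using that by simp
  define u where "u j = S / (m * s (X j))" for j
  have u: "\<tau> / m \<le> u j" if "j \<in> J" for j
  proof -
    have "\<tau> * s (X j) \<le> v j * s (X j)" using X[OF that] spos[of "X j"] by simp
    also have "\<dots> \<le> S" unfolding S_def
      using X spos by (intro member_le_sum that) (auto intro!: mult_nonneg_nonneg less_imp_le \<open>finite J\<close>)
    finally show ?thesis using spos[of "X j"] \<open>0 < m\<close> by (simp add: u_def field_simps)
  qed
  \<comment> \<open>As \<open>u j\<close> is at least \<tau> / \<open>m\<close>, that is
    \<open>7 * e\<close> units of size \<tau> / \<open>N\<close>, rounding down loses at most the
    fraction \<open>1 / (7 * e)\<close> and leaves a positive multiple.\<close>
  define n where "n j = nat \<lfloor>u j * N / \<tau>\<rfloor>" for j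
  define w where "w j = real (n j) * (\<tau> / N)" for j
  have n1: "1 \<le> n j" if "j \<in> J" for j
  proof -
    have "1 \<le> real N / m" using \<open>1 \<le> e\<close> \<open>0 < m\<close> by (simp add: N_def)
    also have "\<dots> = \<tau> / m * N / \<tau>" using \<open>0 < \<tau>\<close> by simp
    also have "\<dots> \<le> u j * N / \<tau>" using u[OF that] \<open>0 < \<tau>\<close> by (intro divide_right_mono mult_right_mono) auto
    finally show ?thesis unfolding n_def by (simp add: le_nat_iff le_floor_iff)
  qed
  have w: "w j \<le> u j" "u j - w j \<le> u j / (7 * e)" if "j \<in> J" for j
  proof -
    have pos: "0 \<le> u j * N / \<tau>" using u[OF that] \<open>0 < \<tau>\<close> \<open>0 < m\<close>
      by (intro divide_nonneg_pos mult_nonneg_nonneg) (auto intro: order_trans[rotated])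
    have n: "real (n j) \<le> u j * N / \<tau>" "u j * N / \<tau> - 1 \<le> real (n j)"
      unfolding n_def using pos by linarith+
    have eq: "u j = u j * N / \<tau> * (\<tau> / N)" using \<open>0 < \<tau>\<close> \<open>0 < N\<close> by simp
    have "w j \<le> u j * N / \<tau> * (\<tau> / N)" unfolding w_def
      using n \<open>0 < \<tau>\<close> by (intro mult_right_mono) auto
    then show "w j \<le> u j" using eq by simp
    have "(u j * N / \<tau> - 1) * (\<tau> / N) \<le> w j" unfolding w_def
      using n \<open>0 < \<tau>\<close> by (intro mult_right_mono) auto
    then have *: "u j - w j \<le> \<tau> / N" using eq unfolding left_diff_distrib by linarith
    have "\<tau> / N = (\<tau> / m) / (7 * e)" by (simp add: N_def)
    also have "\<dots> \<le> u j / (7 * e)" using u[OF that] by (intro divide_right_mono) auto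
    finally show "u j - w j \<le> u j / (7 * e)" using * by simp
  qed
  define c' where "c' = map (\<lambda>j. (X j, w j)) js"
  have pull_c': "pull c' A y = (\<Sum>j\<leftarrow>js. if A (X j) then w j * \<delta> (X j) y else 0)" for A y
    by (simp add: c'_def pull_def comp_def)
  show ?thesis
  proof (intro exI[of _ c'] conjI ballI)
    show "length c' \<le> m" by (simp add: c'_def js)
  next
    fix z assume "z \<in> set c'"
    then obtain j where "j \<in> J" "z = (X j, w j)" using js by (auto simp: c'_def)
    then show "case z of (x, v) \<Rightarrow> x \<in> G \<and> (\<exists>n\<ge>1. v = real n * (\<tau> / real N))"
      using X(1)[OF \<open>j \<in> J\<close>] n1[OF \<open>j \<in> J\<close>] unfolding w_def by blast
  next
    \<comment> \<open>The additive term \<open>2 / mass c\<close> of the sensitivities keeps single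
      weights, and hence the total mass, under control.\<close>
    have "w j \<le> 3 / (m * (2 / mass c))" if "j \<in> J" for j
    proof -
      have "w j \<le> S / (m * s (X j))" using w[OF that] by (simp add: u_def)
      also have "\<dots> \<le> 3 / (m * (2 / mass c))"
        using S3 Spos s(1)[of "X j"] \<open>0 < m\<close> Mpos by (intro frac_le mult_left_mono) auto
      finally show ?thesis .
    qed
    then have "mass c' \<le> (\<Sum>j\<leftarrow>js. 3 / (m * (2 / mass c)))"
      unfolding c'_def mass_def using js by (auto simp: comp_def intro!: sum_list_mono)
    also have "\<dots> = 3 / 2 * mass c" using js \<open>0 < m\<close> by (simp add: sum_list_triv)
    finally show "mass c' \<le> 2 * mass c" using Mpos by simp
  next
    fix A y assume A: "A \<in> \<A>" "y \<in> G"
    \<comment> \<open>The estimate with unrounded weights separates the sampling error from the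
      rounding error. The latter is relative to \<open>T\<close>, whence the bound
      \<open>T \<le> 4 * F y\<close>.\<close>
    define T where "T = (\<Sum>j\<leftarrow>js. if A (X j) then u j * \<delta> (X j) y else 0)"
    have "T = (\<Sum>j\<leftarrow>js. S * F y / m * f (A, y) j)"
      unfolding T_def
    proof (intro arg_cong[of _ _ sum_list] map_cong refl)
      fix j assume "j \<in> set js"
      then have "j \<in> J" using js by auto
      have "u j * \<delta> (X j) y = u j * (s (X j) * F y * (\<delta> (X j) y / (s (X j) * F y)))"
        using ff[OF \<open>j \<in> J\<close> A(2)] by simp
      also have "\<dots> = S * F y / m * (\<delta> (X j) y / (s (X j) * F y))"
        using spos[of "X j"] \<open>0 < m\<close> by (simp add: u_def)
      finally show "(if A (X j) then u j * \<delta> (X j) y else 0) = S * F y / m * f (A, y) j"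
        by (simp add: f_def)
    qed
    then have T: "T = S * F y / m * (\<Sum>j\<leftarrow>js. f (A, y) j)" by (simp only: sum_list_const_mult)
    have P: "pull c A y = S * F y / m * (m * (\<Sum>j\<in>J. p j * f (A, y) j))"
    proof -
      have "pull c A y = (\<Sum>j\<in>J. S * F y * (p j * f (A, y) j))"
        unfolding pull_conv_sum J_def[symmetric] X_def[symmetric] v_def[symmetric]
      proof (rule sum.cong)
        fix j assume "j \<in> J"
        define r where "r = \<delta> (X j) y / (s (X j) * F y)"
        have "\<delta> (X j) y = s (X j) * F y * r" "f (A, y) j = (if A (X j) then r else 0)"
          using ff[OF \<open>j \<in> J\<close> A(2)] by (simp_all add: f_def r_def)
        then show "(if A (X j) then v j * \<delta> (X j) y else 0) = S * F y * (p j * f (A, y) j)"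
          using Spos by (simp add: p_def)
      qed simp
      then show ?thesis using \<open>0 < m\<close> by (simp add: sum_distrib_left mult.assoc)
    qed
    have "T - pull c A y = S * F y / m * ((\<Sum>j\<leftarrow>js. f (A, y) j) - m * (\<Sum>j\<in>J. p j * f (A, y) j))"
      unfolding T P by (simp only: right_diff_distrib)
    then have "\<bar>T - pull c A y\<bar> = S * F y / m * \<bar>(\<Sum>j\<leftarrow>js. f (A, y) j) - m * (\<Sum>j\<in>J. p j * f (A, y) j)\<bar>"
      using Spos F0[of y] by (simp add: abs_mult)
    also have "\<dots> \<le> S * F y / m * (m / (7 * e))"
      using dev[OF A] Spos F0[of y] by (intro mult_left_mono) auto
    also have "\<dots> = S * (F y / (7 * e))" using \<open>0 < m\<close> by simp
    also have "\<dots> \<le> 3 * (F y / (7 * e))" using S3 F0[of y] by (intro mult_right_mono) auto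
    finally have 1: "\<bar>T - pull c A y\<bar> \<le> 3 * (F y / (7 * e))" .
    have "pull c A y \<le> F y" unfolding F_def pull_conv_sum
      using X by (intro sum_mono) (auto simp: J_def X_def v_def dist_nonneg less_imp_le)
    then have "T \<le> F y + 3 * (F y / (7 * e))" using 1 by linarith
    also have "\<dots> \<le> F y + 3 * F y" using F0[of y] \<open>1 \<le> e\<close>
      by (intro add_left_mono mult_left_mono) (auto simp: divide_le_eq mult_le_cancel_left1)
    finally have T4: "T \<le> 4 * F y" by simp
    have pc: "pull c' A y \<le> T" unfolding pull_c' T_def using w js
      by (intro sum_list_mono) (auto intro!: mult_right_mono dist_nonneg)
    have "T - pull c' A y = (\<Sum>j\<leftarrow>js. (if A (X j) then u j * \<delta> (X j) y else 0) - (if A (X j) then w j * \<delta> (X j) y else 0))"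
      by (simp add: pull_c' T_def sum_list_subtractf)
    also have "\<dots> \<le> (\<Sum>j\<leftarrow>js. (1 / (7 * e)) * (if A (X j) then u j * \<delta> (X j) y else 0))"
    proof (rule sum_list_mono)
      fix j assume "j \<in> set js"
      then have "(u j - w j) * \<delta> (X j) y \<le> (u j / (7 * e)) * \<delta> (X j) y"
        using w js by (intro mult_right_mono dist_nonneg) auto
      then show "(if A (X j) then u j * \<delta> (X j) y else 0) - (if A (X j) then w j * \<delta> (X j) y else 0)
        \<le> (1 / (7 * e)) * (if A (X j) then u j * \<delta> (X j) y else 0)"
        by (auto simp: left_diff_distrib)
    qed
    also have "\<dots> = (1 / (7 * e)) * T" by (simp only: T_def sum_list_const_mult)
    also have "\<dots> \<le> (1 / (7 * e)) * (4 * F y)" using T4 by (intro mult_left_mono) auto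
    finally have "T - pull c' A y \<le> 4 * (F y / (7 * e))" by simp
    then have "\<bar>pull c' A y - pull c A y\<bar> \<le> 7 * (F y / (7 * e))" using 1 pc by linarith
    then show "\<bar>pull c' A y - pull c A y\<bar> \<le> pull c (\<lambda>_. True) y / e" by (simp add: F_def)
  qed
qed

end

section \<open>A small class of near-optimal cuts\<close>

lemma sum_list_sum_swap:
  fixes g :: "'b \<Rightarrow> 'c \<Rightarrow> 'd::comm_monoid_add"
  shows "(\<Sum>j\<leftarrow>js. \<Sum>x\<in>X. g j x) = (\<Sum>x\<in>X. \<Sum>j\<leftarrow>js. g j x)"
  by (induction js) (auto simp: sum.distrib)

lemma exists_le_average:
  fixes g :: "'b \<Rightarrow> real" and a :: real
  assumes "js \<noteq> []" "(\<Sum>j\<leftarrow>js. g j) \<le> length js * a"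
  shows "\<exists>j\<in>set js. g j \<le> a"
proof (rule ccontr)
  assume "\<not> ?thesis"
  then have "(\<Sum>j\<leftarrow>js. a) < (\<Sum>j\<leftarrow>js. g j)"
    using assms(1) by (intro sum_list_strict_mono) auto
  then show False using assms(2) by (simp add: sum_list_triv)
qed

text \<open>Overwriting the value at \<open>x\<close> by an arbitrary \<open>k\<close> is injective
  on colliding functions, since the lost value can be read off at \<open>y\<close>.\<close>

lemma card_colliding_functions:
  assumes "finite G" "x \<in> G" "y \<in> G" "x \<noteq> y"
  shows "K * card {\<rho> \<in> G \<rightarrow>\<^sub>E {..<K}. \<rho> x = \<rho> y} \<le> card (G \<rightarrow>\<^sub>E {..<K})"
proof -
  let ?A = "{\<rho> \<in> G \<rightarrow>\<^sub>E {..<K}. \<rho> x = \<rho> y}"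
  have "inj_on (\<lambda>(\<rho>, k). \<rho>(x := k)) (?A \<times> {..<K})"
  proof (rule inj_onI, clarify)
    fix \<rho> k \<rho>' k' assume *: "\<rho> x = \<rho> y" "\<rho>' x = \<rho>' y" "\<rho>(x := k) = \<rho>'(x := k')"
    have "k = k'" using fun_cong[OF *(3), of x] by simp
    moreover have "\<rho> z = \<rho>' z" for z
      using fun_cong[OF *(3), of z] fun_cong[OF *(3), of y] *(1,2) assms(4) by (cases "z = x") auto
    ultimately show "\<rho> = \<rho>' \<and> k = k'" by auto
  qed
  moreover have "(\<lambda>(\<rho>, k). \<rho>(x := k)) ` (?A \<times> {..<K}) \<subseteq> G \<rightarrow>\<^sub>E {..<K}"
    using assms by (auto simp: PiE_iff extensional_def)
  ultimately have "card (?A \<times> {..<K}) \<le> card (G \<rightarrow>\<^sub>E {..<K})"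
    using assms(1) by (intro card_inj_on_le) (auto intro: finite_PiE)
  then show ?thesis by (simp add: card_cartesian_product mult.commute)
qed

section \<open>Uncut distance, hashing into blocks, and greedy decisions from sparse data\<close>

context finite_metric
begin

definition total :: "'a set \<Rightarrow> real" where
  "total X = (\<Sum>x\<in>X. \<Sum>y\<in>X. \<delta> x y)"

text \<open>Ordered pairs are counted, so this is twice the cost of the cut.\<close>

definition uncut :: "'a set \<Rightarrow> ('a \<Rightarrow> bool) \<Rightarrow> real" where
  "uncut X z = (\<Sum>x\<in>X. \<Sum>y\<in>X. if z x = z y then \<delta> x y else 0)"

text \<open>A random map into \<open>K\<close> blocks lets two points collide with probability at
  most \<open>1 / K\<close>. Derandomised sampling gives a short list of maps, independent of
  \<open>X\<close>, in which every pair collides under at most a fraction \<open>2 / K\<close>;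
  averaging over the list yields a map that suits a given \<open>X\<close>.\<close>

lemma exists_hash_family:
  assumes "1 \<le> K" "card G \<le> 2 ^ E"
  shows "\<exists>R. finite R \<and> card R \<le> 4 * (2 * E + 1) * K\<^sup>2 \<and> (\<forall>\<rho>\<in>R. \<forall>x\<in>G. \<rho> x < K) \<and>
    (\<forall>X\<subseteq>G. \<exists>\<rho>\<in>R. (\<Sum>x\<in>X. \<Sum>y\<in>X. if \<rho> x = \<rho> y then \<delta> x y else 0) \<le> 2 / K * total X)"
proof -
  define J where "J = G \<rightarrow>\<^sub>E {..<K}"
  \<comment> \<open>Diagonal pairs always collide and are left out; their distance is
    \<open>0\<close>.\<close>
  define I where "I = {(x, y) \<in> G \<times> G. x \<noteq> y}"
  define m where "m = 4 * (2 * E + 1) * K\<^sup>2"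
  define f :: "'a \<times> 'a \<Rightarrow> ('a \<Rightarrow> nat) \<Rightarrow> real" where "f = (\<lambda>(x, y) \<rho>. if \<rho> x = \<rho> y then 1 else 0)"
  have "(\<lambda>x\<in>G. 0) \<in> J" using assms(1) by (auto simp: J_def)
  moreover have "finite J" using finite_points by (auto simp: J_def intro!: finite_PiE)
  ultimately have J: "finite J" "card J > 0" by (auto simp: card_gt_0_iff)
  have "I \<subseteq> G \<times> G" by (auto simp: I_def)
  then have I: "finite I" "card I \<le> 2 ^ (2 * E)"
  proof -
    show "finite I" using \<open>I \<subseteq> G \<times> G\<close> finite_points finite_subset by blast
    have "card I \<le> card G * card G"
      using card_mono[OF _ \<open>I \<subseteq> G \<times> G\<close>] finite_points by (simp add: card_cartesian_product)
    also have "\<dots> \<le> 2 ^ E * 2 ^ E" using assms by (intro mult_mono) auto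
    finally show "card I \<le> 2 ^ (2 * E)" by (simp add: power_add[symmetric] mult_2)
  qed
  have "\<exists>js. length js = m \<and> set js \<subseteq> {j\<in>J. 0 < 1 / real (card J)} \<and>
    (\<forall>i\<in>I. \<bar>(\<Sum>j\<leftarrow>js. f i j) - real m * (\<Sum>j\<in>J. 1 / real (card J) * f i j)\<bar> \<le> real m / real K)"
    unfolding m_def by (rule exists_sample) (use J I assms in \<open>auto simp: f_def\<close>)
  then obtain js where js: "length js = m" "set js \<subseteq> J"
    and dev: "\<And>i. i \<in> I \<Longrightarrow> \<bar>(\<Sum>j\<leftarrow>js. f i j) - real m * (\<Sum>j\<in>J. 1 / real (card J) * f i j)\<bar> \<le> real m / real K"
    by auto
  have coll: "(\<Sum>\<rho>\<leftarrow>js. f (x, y) \<rho>) \<le> m * (2 / K)" if xy: "x \<in> G" "y \<in> G" "x \<noteq> y" for x y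
  proof -
    have "(\<Sum>j\<in>J. f (x, y) j) = (\<Sum>j\<in>{\<rho>\<in>J. \<rho> x = \<rho> y}. 1)"
      unfolding f_def using J(1) by (simp add: sum.If_cases Int_def conj_commute)
    then have "K * (\<Sum>j\<in>J. f (x, y) j) \<le> card J"
      using of_nat_mono[OF card_colliding_functions[OF finite_points xy, of K], where 'a=real]
      by (simp add: J_def)
    then have "(\<Sum>j\<in>J. 1 / real (card J) * f (x, y) j) \<le> 1 / K"
      using J assms(1) by (simp add: sum_distrib_left[symmetric] sum_divide_distrib[symmetric] field_simps)
    then have "m * (\<Sum>j\<in>J. 1 / real (card J) * f (x, y) j) \<le> m * (1 / K)"
      by (intro mult_left_mono) auto
    moreover have "(x, y) \<in> I" using xy by (simp add: I_def)
    ultimately show ?thesis using dev[of "(x, y)"] by simp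
  qed
  have "m > 0" using assms(1) by (simp add: m_def)
  show ?thesis
  proof (intro exI[of _ "set js"] conjI allI impI ballI)
    show "card (set js) \<le> 4 * (2 * E + 1) * K\<^sup>2" using card_length[of js] js by (simp add: m_def)
    show "\<rho> x < K" if "\<rho> \<in> set js" "x \<in> G" for \<rho> x using that js by (auto simp: J_def PiE_iff)
  next
    fix X assume X: "X \<subseteq> G"
    have "(\<Sum>\<rho>\<leftarrow>js. \<Sum>x\<in>X. \<Sum>y\<in>X. if \<rho> x = \<rho> y then \<delta> x y else 0)
        = (\<Sum>x\<in>X. \<Sum>y\<in>X. \<Sum>\<rho>\<leftarrow>js. \<delta> x y * f (x, y) \<rho>)"
      unfolding sum_list_sum_swap f_def by (intro sum.cong refl arg_cong[of _ _ sum_list] map_cong) auto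
    also have "\<dots> \<le> (\<Sum>x\<in>X. \<Sum>y\<in>X. \<delta> x y * (m * (2 / K)))"
    proof (intro sum_mono)
      fix x y assume "x \<in> X" "y \<in> X"
      then show "(\<Sum>\<rho>\<leftarrow>js. \<delta> x y * f (x, y) \<rho>) \<le> \<delta> x y * (m * (2 / K))"
        unfolding sum_list_const_mult using mult_left_mono[OF coll[of x y] dist_nonneg[of x y]] X
        by (cases "x = y") (auto simp: dist_self)
    qed
    also have "\<dots> = total X * (m * (2 / K))" unfolding total_def by (simp only: sum_distrib_right)
    also have "\<dots> = length js * (2 / K * total X)" using js by simp
    finally show "\<exists>\<rho>\<in>set js. (\<Sum>x\<in>X. \<Sum>y\<in>X. if \<rho> x = \<rho> y then \<delta> x y else 0) \<le> 2 / K * total X"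
      using js \<open>m > 0\<close> by (intro exists_le_average) auto
  qed auto
qed

text \<open>The first order cost of placing \<open>x\<close> on side \<open>b\<close>.\<close>

definition attraction :: "'a set \<Rightarrow> ('a \<Rightarrow> bool) \<Rightarrow> bool \<Rightarrow> 'a \<Rightarrow> real" where
  "attraction X z b x = (\<Sum>y\<in>X. if z y = b then \<delta> y x else 0)"

text \<open>The factor \<open>3\<close>: a pair inside the block contributes at least \<open>- 2\<close> distances to the first order terms
  and at most \<open>1\<close> to the left-hand side.\<close>

lemma uncut_reassign_block:
  assumes z': "\<And>x. z' x = (if S x then s x else z x)"
  shows "uncut X z' \<le> uncut X z
    + 2 * (\<Sum>x\<in>X. if S x then attraction X z (s x) x - attraction X z (z x) x else 0)
    + 3 * (\<Sum>x\<in>X. \<Sum>y\<in>X. if S x \<and> S y then \<delta> x y else 0)"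
proof -
  \<comment> \<open>The first order change on one ordered pair. Either end may move, so
    \<open>g x y + g y x\<close> enters, which gives the factor \<open>2\<close> after swapping the
    sums.\<close>
  define g where "g x y = (if S x then (if z y = s x then \<delta> y x else 0) - (if z y = z x then \<delta> y x else 0) else 0)" for x y
  have 1: "(\<Sum>x\<in>X. if S x then attraction X z (s x) x - attraction X z (z x) x else 0) = (\<Sum>x\<in>X. \<Sum>y\<in>X. g x y)"
    by (intro sum.cong refl) (auto simp: g_def attraction_def sum_subtractf)
  have 2: "(\<Sum>x\<in>X. \<Sum>y\<in>X. g x y) = (\<Sum>x\<in>X. \<Sum>y\<in>X. g y x)" by (rule sum.swap)
  have "uncut X z' \<le> (\<Sum>x\<in>X. \<Sum>y\<in>X. (if z x = z y then \<delta> x y else 0) + (g x y + g y x) + 3 * (if S x \<and> S y then \<delta> x y else 0))"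
    unfolding uncut_def
  proof (intro sum_mono)
    fix x y
    show "(if z' x = z' y then \<delta> x y else 0) \<le> (if z x = z y then \<delta> x y else 0) + (g x y + g y x) + 3 * (if S x \<and> S y then \<delta> x y else 0)"
      unfolding g_def z' using dist_nonneg[of x y] dist_sym[of x y] by auto
  qed
  also have "\<dots> = uncut X z + ((\<Sum>x\<in>X. \<Sum>y\<in>X. g x y) + (\<Sum>x\<in>X. \<Sum>y\<in>X. g y x)) + 3 * (\<Sum>x\<in>X. \<Sum>y\<in>X. if S x \<and> S y then \<delta> x y else 0)"
    by (simp only: sum.distrib uncut_def sum_distrib_left)
  finally show ?thesis using 1 2 by simp
qed

definition sparse :: "nat \<Rightarrow> real \<Rightarrow> nat \<Rightarrow> ('a \<times> real) list set" where
  "sparse m \<tau> B = {c. set c \<subseteq> G \<times> (\<lambda>n. real n * \<tau>) ` {..<B} \<and> length c \<le> m}"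

lemma finite_sparse: "finite (sparse m \<tau> B)"
  unfolding sparse_def using finite_points by (intro finite_lists_length_le) auto

text \<open>Lists of length at most \<open>m\<close> are counted like words of length
  \<open>m\<close> with one additional padding symbol, which accounts for the \<open>+ 1\<close> in
  the exponent.\<close>

lemma card_sparse:
  assumes "card G \<le> 2 ^ E" "B \<le> 2 ^ b"
  shows "card (sparse m \<tau> B) \<le> 2 ^ ((E + b + 1) * m)"
proof -
  define A where "A = G \<times> (\<lambda>n. real n * \<tau>) ` {..<B}"
  have fin: "finite A" using finite_points by (auto simp: A_def)
  have "card A \<le> 2 ^ E * 2 ^ b" unfolding A_def card_cartesian_product
    using assms card_image_le[of "{..<B}" "\<lambda>n. real n * \<tau>"] by (intro mult_mono) auto
  then have "card A + 1 \<le> 2 ^ (E + b) + 2 ^ (E + b)" by (intro add_mono) (auto simp: power_add)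
  then have A: "card A + 1 \<le> 2 ^ (E + b + 1)" by simp
  have "card (sparse m \<tau> B) = (\<Sum>i\<le>m. card A ^ i)"
    unfolding sparse_def A_def[symmetric] using card_lists_length_le[OF fin] by simp
  also have "\<dots> \<le> (card A + 1) ^ m" by (induction m) (auto simp: algebra_simps intro!: add_mono mult_left_mono power_mono)
  also have "\<dots> \<le> (2 ^ (E + b + 1)) ^ m" using A by (intro power_mono) auto
  finally show ?thesis by (simp only: power_mult)
qed

text \<open>The two lists stand for the \<open>True\<close> and the \<open>False\<close> side of a
  cut. Distances within a side are paid, so a point prefers the smaller pull.\<close>

definition side :: "('a \<times> real) list \<times> ('a \<times> real) list \<Rightarrow> 'a \<Rightarrow> bool" where
  "side u x \<longleftrightarrow> pull (fst u) (\<lambda>_. True) x \<le> pull (snd u) (\<lambda>_. True) x"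

definition unit_weights :: "'a list \<Rightarrow> ('a \<times> real) list" where
  "unit_weights xs = map (\<lambda>x. (x, 1)) xs"

lemma pull_unit_weights:
  "distinct xs \<Longrightarrow> pull (unit_weights xs) A y = (\<Sum>x\<in>set xs. if A x then \<delta> x y else 0)"
  by (induction xs) (auto simp: unit_weights_def)

lemma mass_unit_weights: "mass (unit_weights xs) = length xs"
  by (induction xs) (auto simp: unit_weights_def)

lemma pull_filter: "pull (filter (\<lambda>(x, v). P x) c) A y = pull c (\<lambda>x. P x \<and> A x) y"
  by (induction c) auto

lemma weight_le_mass: "\<forall>(x, v)\<in>set c. 0 \<le> v \<Longrightarrow> (x, v) \<in> set c \<Longrightarrow> v \<le> mass c"
proof (induction c)
  case (Cons a c)
  have "0 \<le> mass c'" if "\<forall>(x, v)\<in>set c'. 0 \<le> v" for c' :: "('a \<times> real) list"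
    using that by (induction c') auto
  from this[of c] show ?case using Cons by fastforce
qed auto

text \<open>Sparsifying \<open>X\<close> with respect to the two sides of \<open>z\<close> estimates
  both attractions up to \<open>1 / e\<close> of the total distance, and comparing two such
  estimates doubles the error. The decision depends on \<open>z\<close> through the sparse pair
  \<open>u\<close> alone.\<close>

lemma exists_greedy_side:
  fixes E e :: nat
  defines "m \<equiv> 196 * (E + 2) * e\<^sup>2"
  defines "N \<equiv> 7 * e * m"
  assumes E: "card G \<le> 2 ^ E" and e: "1 \<le> e" and X: "X \<subseteq> G"
  shows "\<exists>u\<in>sparse m (1 / N) (2 ^ (E + 2) * N) \<times> sparse m (1 / N) (2 ^ (E + 2) * N).
    \<forall>x\<in>G. \<forall>b. attraction X z (side u x) x \<le> attraction X z b x + 2 / e * (\<Sum>y\<in>X. \<delta> y x)"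
proof -
  have "0 < m" "0 < N" using e by (auto simp: m_def N_def)
  have "finite X" using X finite_points finite_subset by blast
  then obtain xs where xs: "set xs = X" "distinct xs" using finite_distinct_list by blast
  define c where "c = unit_weights xs"
  \<comment> \<open>Two sets and at most \<open>2 ^ E\<close> points give the exponent
    \<open>q = E + 1\<close>, hence the factor \<open>E + 2\<close> in \<open>m\<close>.\<close>
  define \<A> where "\<A> = {z, \<lambda>x. \<not> z x}"
  have m': "m = 196 * (E + 1 + 1) * e\<^sup>2" by (simp add: m_def)
  have "card \<A> * card G \<le> 2 * 2 ^ E" using E card_insert_le_m1[of 2 "{\<lambda>x. \<not> z x}" z]
    by (intro mult_mono) (auto simp: \<A>_def)
  then have "\<exists>c'. length c' \<le> m \<and> (\<forall>(x, v)\<in>set c'. x \<in> G \<and> (\<exists>n\<ge>1. v = real n * (1 / N)))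
    \<and> mass c' \<le> 2 * mass c
    \<and> (\<forall>A\<in>\<A>. \<forall>y\<in>G. \<bar>pull c' A y - pull c A y\<bar> \<le> pull c (\<lambda>_. True) y / e)"
    unfolding N_def m' by (intro exists_sparse_weights)
      (use X xs e in \<open>auto simp: \<A>_def c_def unit_weights_def\<close>)
  then obtain c' where c': "length c' \<le> m" "\<forall>(x, v)\<in>set c'. x \<in> G \<and> (\<exists>n\<ge>1. v = real n * (1 / N))"
    "mass c' \<le> 2 * mass c" and ap: "\<And>A y. A \<in> \<A> \<Longrightarrow> y \<in> G \<Longrightarrow> \<bar>pull c' A y - pull c A y\<bar> \<le> pull c (\<lambda>_. True) y / e"
    by blast
  have set_c': "set c' \<subseteq> G \<times> (\<lambda>n. real n * (1 / N)) ` {..<2 ^ (E + 2) * N}"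
  proof
    fix a assume a: "a \<in> set c'"
    then obtain x n where n: "a = (x, real n * (1 / N))" "x \<in> G" using bspec[OF c'(2) a] by (cases a) auto
    have "real n * (1 / N) \<le> mass c'"
      using c'(2) a unfolding n by (intro weight_le_mass) auto
    also have "\<dots> \<le> 2 * real (card G)"
      using c'(3) distinct_card[OF xs(2)] card_mono[OF finite_points X] xs(1) by (simp add: c_def mass_unit_weights)
    also have "\<dots> \<le> 2 * 2 ^ E" using of_nat_mono[OF E, where 'a=real] by simp
    also have "\<dots> < (2::real) ^ (E + 2)" by simp
    finally have "real n < 2 ^ (E + 2) * N" using \<open>0 < N\<close> by (simp add: field_simps)
    then have "real n < real (2 ^ (E + 2) * N)" by simp
    then have "n < 2 ^ (E + 2) * N" by (simp only: of_nat_less_iff)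
    then show "a \<in> G \<times> (\<lambda>n. real n * (1 / N)) ` {..<2 ^ (E + 2) * N}" using n by auto
  qed
  define u where "u = (filter (\<lambda>(x, v). z x) c', filter (\<lambda>(x, v). \<not> z x) c')"
  have u: "u \<in> sparse m (1 / N) (2 ^ (E + 2) * N) \<times> sparse m (1 / N) (2 ^ (E + 2) * N)"
    using set_c' c'(1) by (auto simp: u_def sparse_def intro: order_trans[OF length_filter_le])
  have att: "attraction X z b x = pull c (\<lambda>y. z y = b) x" for b x
    by (simp add: attraction_def c_def pull_unit_weights xs)
  have F: "(\<Sum>y\<in>X. \<delta> y x) = pull c (\<lambda>_. True) x" for x
    by (simp add: c_def pull_unit_weights xs)
  have "attraction X z (side u x) x \<le> attraction X z b x + 2 / e * (\<Sum>y\<in>X. \<delta> y x)" if x: "x \<in> G" for x b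
  proof -
    define D where "D = pull c (\<lambda>_. True) x / e"
    have D: "D \<ge> 0" unfolding D_def F[symmetric] by (auto intro!: divide_nonneg_nonneg sum_nonneg dist_nonneg)
    have side: "side u x \<longleftrightarrow> pull c' z x \<le> pull c' (\<lambda>x. \<not> z x) x"
      by (simp add: side_def u_def pull_filter)
    have p: "\<bar>pull c' z x - attraction X z True x\<bar> \<le> D" "\<bar>pull c' (\<lambda>x. \<not> z x) x - attraction X z False x\<bar> \<le> D"
      using ap[of z x] ap[of "\<lambda>x. \<not> z x" x] x by (auto simp: att D_def \<A>_def)
    have "attraction X z (side u x) x \<le> attraction X z b x + 2 * D"
      using p D side by (cases "side u x"; cases b) auto
    then show ?thesis by (simp add: D_def F)
  qed
  then show ?thesis using u by blast
qed

end

text \<open>The exponent of the size of the class of cuts. The first summand pays for the hash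
  function, the second for a pair of sparse lists in each of \<open>12 * E\<close> blocks.\<close>

definition cut_class_bits :: "nat \<Rightarrow> nat" where
  "cut_class_bits E = (let m = 196 * (E + 2) * (8 * E)\<^sup>2; N = 7 * (8 * E) * m in
     4 * (2 * E + 1) * (12 * E)\<^sup>2 + (E + (E + 2 + N) + 1) * m * 2 * (12 * E))"

lemma le_two_power: "n \<le> (2::nat) ^ n"
  using less_exp[of n] by simp

section \<open>Assembling the class of cuts\<close>

context finite_metric
begin

text \<open>An arbitrary cut \<open>z\<close> is replaced block by block, every block moving to the side that a sparse
  estimate of the attractions exerted by the current cut prefers.\<close>

lemma exists_blockwise_greedy_cut:
  fixes E e :: nat
  defines "m \<equiv> 196 * (E + 2) * e\<^sup>2"
  defines "N \<equiv> 7 * e * m"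
  defines "U \<equiv> sparse m (1 / N) (2 ^ (E + 2) * N)"
  assumes E: "card G \<le> 2 ^ E" and e: "1 \<le> e" and X: "X \<subseteq> G"
  shows "\<exists>us. length us = k \<and> set us \<subseteq> U \<times> U \<and>
    uncut X (\<lambda>x. if \<rho> x < k then side (us ! \<rho> x) x else z x) \<le> uncut X z
     + 4 / e * (\<Sum>x\<in>X. if \<rho> x < k then (\<Sum>y\<in>X. \<delta> y x) else 0)
     + 3 * (\<Sum>x\<in>X. \<Sum>y\<in>X. if \<rho> x = \<rho> y \<and> \<rho> x < k then \<delta> x y else 0)"
proof (induction k)
  case 0
  show ?case by (auto intro!: exI[of _ "[]"])
next
  case (Suc k)
  define F where "F x = (\<Sum>y\<in>X. \<delta> y x)" for x
  define P where "P k = (\<Sum>x\<in>X. if \<rho> x < k then F x else 0)" for k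
  define C where "C k = (\<Sum>x\<in>X. \<Sum>y\<in>X. if \<rho> x = \<rho> y \<and> \<rho> x < k then \<delta> x y else 0)" for k
  obtain us where us: "length us = k" "set us \<subseteq> U \<times> U"
    and IH: "uncut X (\<lambda>x. if \<rho> x < k then side (us ! \<rho> x) x else z x) \<le> uncut X z + 4 / e * P k + 3 * C k"
    using Suc.IH unfolding P_def C_def F_def by blast
  define y where "y x = (if \<rho> x < k then side (us ! \<rho> x) x else z x)" for x
  obtain u where u: "u \<in> U \<times> U"
    and greedy: "\<And>x b. x \<in> G \<Longrightarrow> attraction X y (side u x) x \<le> attraction X y b x + 2 / e * F x"
    using exists_greedy_side[OF E e X, of y] unfolding F_def U_def N_def m_def by blast
  define y' where "y' x = (if \<rho> x < Suc k then side ((us @ [u]) ! \<rho> x) x else z x)" for x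
  have y': "y' x = (if \<rho> x = k then side u x else y x)" for x
    using us(1) by (auto simp: y'_def y_def nth_append less_Suc_eq)
  have "uncut X y' \<le> uncut X y
    + 2 * (\<Sum>x\<in>X. if \<rho> x = k then attraction X y (side u x) x - attraction X y (y x) x else 0)
    + 3 * (\<Sum>x\<in>X. \<Sum>y\<in>X. if \<rho> x = k \<and> \<rho> y = k then \<delta> x y else 0)"
    by (rule uncut_reassign_block) (rule y')
  also have "\<dots> \<le> (uncut X z + 4 / e * P k + 3 * C k)
    + 2 * (\<Sum>x\<in>X. 2 / e * (if \<rho> x = k then F x else 0))
    + 3 * (\<Sum>x\<in>X. \<Sum>y\<in>X. if \<rho> x = k \<and> \<rho> y = k then \<delta> x y else 0)"
  proof (intro add_mono mult_left_mono sum_mono)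
    show "uncut X y \<le> uncut X z + 4 / e * P k + 3 * C k" using IH by (simp add: y_def[abs_def])
    \<comment> \<open>With the present side \<open>y x\<close> as competitor, the loss is at most
      the estimation error.\<close>
    show "(if \<rho> x = k then attraction X y (side u x) x - attraction X y (y x) x else 0)
      \<le> 2 / e * (if \<rho> x = k then F x else 0)" if "x \<in> X" for x
      using greedy[of x "y x"] that X by auto
  qed auto
  also have "\<dots> = uncut X z + 4 / e * (P k + (\<Sum>x\<in>X. if \<rho> x = k then F x else 0))
    + 3 * (C k + (\<Sum>x\<in>X. \<Sum>y\<in>X. if \<rho> x = k \<and> \<rho> y = k then \<delta> x y else 0))"
    unfolding sum_distrib_left[symmetric] by (simp add: algebra_simps)
  also have "P k + (\<Sum>x\<in>X. if \<rho> x = k then F x else 0) = P (Suc k)"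
    unfolding P_def sum.distrib[symmetric] by (intro sum.cong) auto
  also have "C k + (\<Sum>x\<in>X. \<Sum>y\<in>X. if \<rho> x = k \<and> \<rho> y = k then \<delta> x y else 0) = C (Suc k)"
    unfolding C_def sum.distrib[symmetric] by (intro sum.cong) auto
  finally show ?case
    using us u unfolding P_def C_def F_def y'_def
    by (intro exI[of _ "us @ [u]"] conjI) auto
qed

lemma exists_cut_class:
  assumes "1 \<le> E" "card G \<le> 2 ^ E"
  shows "\<exists>H. finite H \<and> card H \<le> 2 ^ cut_class_bits E \<and>
    (\<forall>X\<subseteq>G. \<forall>z. \<exists>h\<in>H. uncut X h \<le> uncut X z + total X / E)"
proof -
  \<comment> \<open>With these constants the greedy error \<open>4 / e\<close> and the block error
    \<open>6 / K\<close> are both \<open>1 / (2 * E)\<close>.\<close>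
  define e where "e = 8 * E"
  define K where "K = 12 * E"
  define m where "m = 196 * (E + 2) * e\<^sup>2"
  define N where "N = 7 * e * m"
  define U where "U = sparse m (1 / N) (2 ^ (E + 2) * N)"
  have "1 \<le> K" "1 \<le> e" using assms by (auto simp: K_def e_def)
  then obtain R where R: "finite R" "card R \<le> 4 * (2 * E + 1) * K\<^sup>2" "\<And>\<rho> x. \<rho> \<in> R \<Longrightarrow> x \<in> G \<Longrightarrow> \<rho> x < K"
    "\<And>X. X \<subseteq> G \<Longrightarrow> \<exists>\<rho>\<in>R. (\<Sum>x\<in>X. \<Sum>y\<in>X. if \<rho> x = \<rho> y then \<delta> x y else 0) \<le> 2 / K * total X"
    using exists_hash_family[OF \<open>1 \<le> K\<close> assms(2)] by blast
  define Us where "Us = {us. set us \<subseteq> U \<times> U \<and> length us = K}"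
  define H where "H = (\<lambda>(\<rho>, us) x. side (us ! \<rho> x) x) ` (R \<times> Us)"
  have finU: "finite U" unfolding U_def by (rule finite_sparse)
  then have finUs: "finite Us" unfolding Us_def by (intro finite_lists_length_eq) auto
  show ?thesis
  proof (intro exI[of _ H] conjI allI impI)
    show "finite H" using R finUs by (auto simp: H_def)
    have "2 ^ (E + 2) * N \<le> 2 ^ (E + 2 + N)" by (simp add: power_add le_two_power)
    then have cU: "card U \<le> 2 ^ ((E + (E + 2 + N) + 1) * m)"
      unfolding U_def by (intro card_sparse assms)
    have "card Us = (card U * card U) ^ K"
      unfolding Us_def using finU by (simp add: card_lists_length_eq card_cartesian_product)
    also have "\<dots> \<le> (2 ^ ((E + (E + 2 + N) + 1) * m) * 2 ^ ((E + (E + 2 + N) + 1) * m)) ^ K"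
      using cU by (intro power_mono mult_mono) auto
    also have "\<dots> = 2 ^ ((E + (E + 2 + N) + 1) * m * 2 * K)"
      by (simp only: power_add[symmetric] power_mult[symmetric] mult_2_right)
    finally have cUs: "card Us \<le> 2 ^ ((E + (E + 2 + N) + 1) * m * 2 * K)" .
    have "card H \<le> card R * card Us"
      unfolding H_def card_cartesian_product[symmetric] using R finUs by (intro card_image_le) auto
    also have "\<dots> \<le> 2 ^ (4 * (2 * E + 1) * K\<^sup>2) * 2 ^ ((E + (E + 2 + N) + 1) * m * 2 * K)"
      using order_trans[OF R(2) le_two_power] cUs by (rule mult_mono) auto
    also have "\<dots> = 2 ^ cut_class_bits E"
      unfolding power_add[symmetric] by (simp only: cut_class_bits_def Let_def N_def m_def e_def K_def)
    finally show "card H \<le> 2 ^ cut_class_bits E" .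
  next
    fix X z assume X: "X \<subseteq> G"
    obtain \<rho> where \<rho>: "\<rho> \<in> R" "(\<Sum>x\<in>X. \<Sum>y\<in>X. if \<rho> x = \<rho> y then \<delta> x y else 0) \<le> 2 / K * total X"
      using R(4)[OF X] by blast
    have lt: "\<rho> x < K" if "x \<in> X" for x using R(3)[OF \<rho>(1)] that X by auto
    obtain us where us: "length us = K" "set us \<subseteq> U \<times> U" and
      le: "uncut X (\<lambda>x. if \<rho> x < K then side (us ! \<rho> x) x else z x) \<le> uncut X z
       + 4 / e * (\<Sum>x\<in>X. if \<rho> x < K then (\<Sum>y\<in>X. \<delta> y x) else 0)
       + 3 * (\<Sum>x\<in>X. \<Sum>y\<in>X. if \<rho> x = \<rho> y \<and> \<rho> x < K then \<delta> x y else 0)"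
      using exists_blockwise_greedy_cut[OF assms(2) \<open>1 \<le> e\<close> X, of K \<rho> z] unfolding U_def N_def m_def by blast
    define h where "h x = side (us ! \<rho> x) x" for x
    have "uncut X (\<lambda>x. if \<rho> x < K then side (us ! \<rho> x) x else z x) = uncut X h"
      unfolding uncut_def using lt by (intro sum.cong refl) (auto simp: h_def)
    moreover have "(\<Sum>x\<in>X. if \<rho> x < K then (\<Sum>y\<in>X. \<delta> y x) else 0) = total X"
      unfolding total_def using lt by (intro sum.cong refl) (auto simp: dist_sym)
    moreover have "(\<Sum>x\<in>X. \<Sum>y\<in>X. if \<rho> x = \<rho> y \<and> \<rho> x < K then \<delta> x y else 0)
        = (\<Sum>x\<in>X. \<Sum>y\<in>X. if \<rho> x = \<rho> y then \<delta> x y else 0)"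
      using lt by (intro sum.cong refl) auto
    ultimately have "uncut X h \<le> uncut X z + 4 / e * total X + 3 * (2 / K * total X)"
      using le \<rho>(2) by simp
    also have "\<dots> = uncut X z + total X / E" using assms(1) by (simp add: e_def K_def field_simps)
    finally have "uncut X h \<le> uncut X z + total X / E" .
    moreover have "h \<in> H" unfolding H_def using \<rho>(1) us
      by (intro image_eqI[of _ _ "(\<rho>, us)"]) (auto simp: h_def Us_def)
    ultimately show "\<exists>h\<in>H. uncut X h \<le> uncut X z + total X / E" by blast
  qed
qed

end

section \<open>Merge and reduce\<close>

type_synonym 'a slots = "('a \<times> real) list option list"

text \<open>The full set belongs to the family because errors are measured relative to the total
  pull, which itself has to be preserved from level to level.\<close>

locale merge_reduce = finite_metric +
  fixes \<A> :: "('a \<Rightarrow> bool) set" and q e :: nat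
  assumes finite_family: "finite \<A>" and card_family: "card \<A> * card G \<le> 2 ^ q"
    and True_family: "(\<lambda>_. True) \<in> \<A>" and accuracy: "1 \<le> e"
begin

definition size_bound :: nat where "size_bound = 196 * (q + 1) * e\<^sup>2"

definition refinement :: nat where "refinement = 7 * e * size_bound"

definition unit_pull :: "'a multiset \<Rightarrow> ('a \<Rightarrow> bool) \<Rightarrow> 'a \<Rightarrow> real" where
  "unit_pull Y A y = (\<Sum>x\<in>#Y. if A x then \<delta> x y else 0)"

text \<open>The invariant after \<open>l\<close> rounds of reduction. The mass bound has base
  \<open>4\<close> since merging and reducing can each double it. The condition
  \<open>n \<ge> 1\<close> provides the lower bound on weights that the next reduction
  requires.\<close>

definition coreset :: "nat \<Rightarrow> ('a \<times> real) list \<Rightarrow> 'a multiset \<Rightarrow> bool" where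
  "coreset l c Y \<longleftrightarrow> length c \<le> size_bound \<and>
     (\<forall>(x, v)\<in>set c. x \<in> G \<and> (\<exists>n\<ge>1. v = real n * (1 / real refinement ^ l))) \<and> mass c \<le> 4 ^ l \<and>
     (\<forall>A\<in>\<A>. \<forall>y\<in>G. \<bar>pull c A y - unit_pull Y A y\<bar> \<le> ((1 + 1 / e) ^ l - 1) * unit_pull Y (\<lambda>_. True) y)"

text \<open>Hilbert choice turns the existence of sparse weights into a fixed function, with the
  weight unit of level \<open>l\<close> in the role of \<tau>.\<close>

definition reduce :: "nat \<Rightarrow> ('a \<times> real) list \<Rightarrow> ('a \<times> real) list" where
  "reduce l c = (SOME c'. length c' \<le> size_bound \<and>
     (\<forall>(x, v)\<in>set c'. x \<in> G \<and> (\<exists>n\<ge>1. v = real n * ((1 / real refinement ^ l) / refinement))) \<and> mass c' \<le> 2 * mass c \<and>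
     (\<forall>A\<in>\<A>. \<forall>y\<in>G. \<bar>pull c' A y - pull c A y\<bar> \<le> pull c (\<lambda>_. True) y / e))"

text \<open>A binary counter: an occupied slot at level \<open>l\<close> holds a coreset of exactly \<open>2 ^ l\<close> of the points.\<close>

fun carry :: "nat \<Rightarrow> ('a \<times> real) list \<Rightarrow> 'a slots \<Rightarrow> 'a slots" where
  "carry l c [] = []"
| "carry l c (None # s) = Some c # s"
| "carry l c (Some c' # s) = None # carry (Suc l) (reduce l (c @ c')) s"

fun represents :: "nat \<Rightarrow> 'a slots \<Rightarrow> 'a multiset \<Rightarrow> bool" where
  "represents l [] Y \<longleftrightarrow> Y = {#}"
| "represents l (None # s) Y \<longleftrightarrow> represents (Suc l) s Y"
| "represents l (Some c # s) Y \<longleftrightarrow>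
     (\<exists>Y1 Y2. Y = Y1 + Y2 \<and> size Y1 = 2 ^ l \<and> coreset l c Y1 \<and> represents (Suc l) s Y2)"

definition contents :: "'a slots \<Rightarrow> ('a \<times> real) list" where
  "contents s = concat (map (case_option [] id) s)"

lemma contents_simps [simp]:
  "contents [] = []" "contents (None # s) = contents s" "contents (Some c # s) = c @ contents s"
  by (auto simp: contents_def)

lemma size_bound_ge_1: "1 \<le> size_bound"
  using accuracy by (simp add: size_bound_def)

lemma refinement_ge_1: "1 \<le> refinement"
  using accuracy size_bound_ge_1 by (simp add: refinement_def)

lemma unit_pull_simps [simp]:
  "unit_pull {#} A y = 0" "unit_pull {#x#} A y = (if A x then \<delta> x y else 0)"
  "unit_pull (Y + Y') A y = unit_pull Y A y + unit_pull Y' A y"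
  by (auto simp: unit_pull_def)

lemma unit_pull_nonneg: "0 \<le> unit_pull Y A y"
  unfolding unit_pull_def by (induction Y) (auto simp: dist_nonneg)

lemma reduce:
  assumes "\<forall>(x, v)\<in>set c. x \<in> G \<and> 1 / real refinement ^ l \<le> v"
  shows "length (reduce l c) \<le> size_bound"
    and "\<forall>(x, v)\<in>set (reduce l c). x \<in> G \<and> (\<exists>n\<ge>1. v = real n * ((1 / real refinement ^ l) / refinement))"
    and "mass (reduce l c) \<le> 2 * mass c"
    and "\<And>A y. A \<in> \<A> \<Longrightarrow> y \<in> G \<Longrightarrow> \<bar>pull (reduce l c) A y - pull c A y\<bar> \<le> pull c (\<lambda>_. True) y / e"
proof -
  have "0 < 1 / real refinement ^ l" using refinement_ge_1 by simp
  from exists_sparse_weights[OF assms this finite_family card_family accuracy]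
  have "length (reduce l c) \<le> size_bound \<and>
     (\<forall>(x, v)\<in>set (reduce l c). x \<in> G \<and> (\<exists>n\<ge>1. v = real n * ((1 / real refinement ^ l) / refinement))) \<and>
     mass (reduce l c) \<le> 2 * mass c \<and>
     (\<forall>A\<in>\<A>. \<forall>y\<in>G. \<bar>pull (reduce l c) A y - pull c A y\<bar> \<le> pull c (\<lambda>_. True) y / e)"
    unfolding reduce_def size_bound_def[symmetric] refinement_def[symmetric] by (rule someI_ex)
  then show "length (reduce l c) \<le> size_bound"
    and "\<forall>(x, v)\<in>set (reduce l c). x \<in> G \<and> (\<exists>n\<ge>1. v = real n * ((1 / real refinement ^ l) / refinement))"
    and "mass (reduce l c) \<le> 2 * mass c"
    and "\<And>A y. A \<in> \<A> \<Longrightarrow> y \<in> G \<Longrightarrow> \<bar>pull (reduce l c) A y - pull c A y\<bar> \<le> pull c (\<lambda>_. True) y / e"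
    by blast+
qed

lemma coreset_singleton: "x \<in> G \<Longrightarrow> coreset 0 [(x, 1)] {#x#}"
  unfolding coreset_def using size_bound_ge_1 by (auto intro: exI[of _ 1])

text \<open>Concatenation keeps the relative error \<open>t - 1\<close>, as pulls are additive.
  Reduction adds at most \<open>t / e\<close>, because the total pull of the concatenation may
  exceed the true one by the factor \<open>t\<close>; and \<open>t - 1 + t / e\<close> is the error
  of the next level.\<close>

lemma coreset_merge:
  assumes "coreset l c Y" "coreset l c' Y'"
  shows "coreset (Suc l) (reduce l (c @ c')) (Y + Y')"
proof -
  define t where "t = (1 + 1 / real e) ^ l"
  define F where "F = unit_pull (Y + Y') (\<lambda>_. True)"
  have ge: "1 / real refinement ^ l \<le> v" if "n \<ge> 1" "v = real n * (1 / real refinement ^ l)" for n v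
    using that by (simp add: divide_right_mono)
  have "\<forall>(x, v)\<in>set (c @ c'). x \<in> G \<and> 1 / real refinement ^ l \<le> v"
    using assms ge unfolding coreset_def set_append by blast
  note red = reduce[OF this]
  have merged: "\<bar>pull (c @ c') A y - unit_pull (Y + Y') A y\<bar> \<le> (t - 1) * F y" if "A \<in> \<A>" "y \<in> G" for A y
  proof -
    have "\<bar>pull c A y - unit_pull Y A y\<bar> \<le> (t - 1) * unit_pull Y (\<lambda>_. True) y"
      "\<bar>pull c' A y - unit_pull Y' A y\<bar> \<le> (t - 1) * unit_pull Y' (\<lambda>_. True) y"
      using assms that unfolding coreset_def t_def by blast+
    then show ?thesis by (simp add: F_def distrib_left)
  qed
  have "\<bar>pull (reduce l (c @ c')) A y - unit_pull (Y + Y') A y\<bar> \<le> ((1 + 1 / e) ^ Suc l - 1) * F y"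
    if A: "A \<in> \<A>" "y \<in> G" for A y
  proof -
    have "unit_pull (Y + Y') (\<lambda>_. True) y = F y" by (simp add: F_def)
    then have "pull (c @ c') (\<lambda>_. True) y \<le> t * F y"
      using merged[OF True_family A(2)] by (simp add: left_diff_distrib)
    then have "pull (c @ c') (\<lambda>_. True) y / e \<le> t * F y / e" by (intro divide_right_mono) auto
    then have "\<bar>pull (reduce l (c @ c')) A y - unit_pull (Y + Y') A y\<bar> \<le> t * F y / e + (t - 1) * F y"
      using red(4)[OF A] merged[OF A] by linarith
    also have "\<dots> = ((1 + 1 / e) ^ Suc l - 1) * F y" by (simp add: t_def algebra_simps)
    finally show ?thesis .
  qed
  moreover have "mass (reduce l (c @ c')) \<le> 4 ^ Suc l"
    using red(3) assms by (simp add: coreset_def)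
  moreover have "\<forall>(x, v)\<in>set (reduce l (c @ c')). x \<in> G \<and> (\<exists>n\<ge>1. v = real n * (1 / real refinement ^ Suc l))"
    using red(2) by (simp add: mult.commute)
  ultimately show ?thesis using red(1) unfolding coreset_def F_def by blast
qed

text \<open>A carry out of the last slot is lost, but it would consist of \<open>2 ^ L\<close> points.\<close>

lemma represents_carry:
  assumes "represents l s Y" "l + length s = L" "coreset l c Y'" "size Y' = 2 ^ l" "size Y + 2 ^ l < 2 ^ L"
  shows "represents l (carry l c s) (Y' + Y)"
  using assms
proof (induction l c s arbitrary: Y Y' rule: carry.induct)
  case (3 l c c' s)
  then obtain Y1 Y2 where Y: "Y = Y1 + Y2" "size Y1 = 2 ^ l" "coreset l c' Y1" "represents (Suc l) s Y2"
    by auto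
  have "represents (Suc l) (carry (Suc l) (reduce l (c @ c')) s) ((Y' + Y1) + Y2)"
    using "3.prems" Y by (intro "3.IH" coreset_merge) auto
  then show ?case by (simp add: Y(1) add.assoc)
qed auto

lemma length_carry [simp]: "length (carry l c s) = length s"
  by (induction l c s rule: carry.induct) auto

lemma represents_replicate_None: "represents l (replicate k None) {#}"
  by (induction k arbitrary: l) auto

lemma represents_fold_carry:
  assumes "set xs \<subseteq> G" "length xs < 2 ^ L"
  shows "represents 0 (fold (\<lambda>x. carry 0 [(x, 1)]) xs (replicate L None)) (mset xs)
    \<and> length (fold (\<lambda>x. carry 0 [(x, 1)]) xs (replicate L None)) = L"
  using assms
proof (induction xs rule: rev_induct)
  case (snoc x xs)
  then have "represents 0 (carry 0 [(x, 1)] (fold (\<lambda>x. carry 0 [(x, 1)]) xs (replicate L None))) ({#x#} + mset xs)"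
    by (intro represents_carry[where L = L] coreset_singleton) auto
  then show ?case using snoc by simp
qed (simp add: represents_replicate_None)

text \<open>Weights of every level up to \<open>L\<close> are rewritten with the common unit of
  level \<open>L\<close>, so that a single finite set contains all coresets that can occur.\<close>

lemma coreset_sparse:
  assumes "coreset l c Y" "l \<le> L"
  shows "c \<in> sparse size_bound (1 / real refinement ^ L) ((4 * refinement) ^ L + 1)"
proof -
  have "a \<in> G \<times> (\<lambda>n. real n * (1 / real refinement ^ L)) ` {..<(4 * refinement) ^ L + 1}" if a: "a \<in> set c" for a
  proof -
    let ?N = "real refinement"
    have N: "?N \<ge> 1" using refinement_ge_1 by simp
    have wt: "\<forall>(x, v)\<in>set c. x \<in> G \<and> (\<exists>n\<ge>1. v = real n * (1 / real refinement ^ l))" and ms: "mass c \<le> 4 ^ l"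
      using assms by (auto simp: coreset_def)
    obtain x n where n: "a = (x, real n * (1 / real refinement ^ l))" "x \<in> G" using bspec[OF wt a] by (cases a) auto
    have "\<forall>(x, v)\<in>set c. 0 \<le> v" using wt by auto
    then have "real n * (1 / real refinement ^ l) \<le> mass c"
      using a unfolding n by (rule weight_le_mass)
    then have "real n / ?N ^ l \<le> 4 ^ l" using ms by simp
    then have "real n \<le> 4 ^ l * ?N ^ l" using N by (simp add: divide_le_eq)
    then have "real n * ?N ^ (L - l) \<le> 4 ^ l * ?N ^ l * ?N ^ (L - l)" using N by (intro mult_right_mono) auto
    also have "\<dots> = 4 ^ l * ?N ^ L" using assms(2) by (simp add: mult.assoc power_add[symmetric])
    also have "\<dots> \<le> 4 ^ L * ?N ^ L" using assms(2) N by (intro mult_right_mono power_increasing) auto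
    finally have "real (n * refinement ^ (L - l)) \<le> real ((4 * refinement) ^ L)"
      by (simp add: power_mult_distrib)
    then have "n * refinement ^ (L - l) < (4 * refinement) ^ L + 1" by (simp only: of_nat_le_iff)
    moreover have "real n * (1 / real refinement ^ l) = real (n * refinement ^ (L - l)) * (1 / real refinement ^ L)"
      using N power_add[of ?N "L - l" l] assms(2) by (simp add: field_simps)
    ultimately show ?thesis unfolding n(1)
      by (intro SigmaI n(2) image_eqI[of _ _ "n * refinement ^ (L - l)"]) auto
  qed
  then show ?thesis using assms(1) unfolding sparse_def coreset_def by blast
qed

lemma represents_slots:
  assumes "represents l s Y" "l + length s = L"
  shows "set s \<subseteq> insert None (Some ` sparse size_bound (1 / real refinement ^ L) ((4 * refinement) ^ L + 1))"
  using assms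
proof (induction l s Y rule: represents.induct)
  case (3 l c s Y)
  then obtain Y1 Y2 where Y: "coreset l c Y1" "represents (Suc l) s Y2" by auto
  have "c \<in> sparse size_bound (1 / real refinement ^ L) ((4 * refinement) ^ L + 1)"
    using Y(1) "3.prems" by (intro coreset_sparse) auto
  then show ?case using "3.IH"[OF Y(2)] "3.prems" by simp
qed auto

lemma represents_contents:
  "represents l s Y \<Longrightarrow> \<forall>(x, v)\<in>set (contents s). x \<in> G \<and> 0 \<le> v"
proof (induction l s Y rule: represents.induct)
  case (3 l c s Y)
  then obtain Y1 Y2 where "coreset l c Y1" "represents (Suc l) s Y2" by auto
  then show ?case using "3.IH" by (auto simp: coreset_def)
qed auto

text \<open>The occupied slots split the points seen so far, and errors relative to the total pull
  add up over this splitting. The error factor of level \<open>L\<close> dominates those of all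
  slots.\<close>

lemma represents_pull:
  assumes "represents l s Y" "l + length s \<le> L" "A \<in> \<A>" "y \<in> G"
  shows "\<bar>pull (contents s) A y - unit_pull Y A y\<bar> \<le> ((1 + 1 / e) ^ L - 1) * unit_pull Y (\<lambda>_. True) y"
  using assms
proof (induction l s Y rule: represents.induct)
  case (3 l c s Y)
  then obtain Y1 Y2 where Y: "Y = Y1 + Y2" "coreset l c Y1" "represents (Suc l) s Y2" by auto
  have "\<bar>pull c A y - unit_pull Y1 A y\<bar> \<le> ((1 + 1 / e) ^ l - 1) * unit_pull Y1 (\<lambda>_. True) y"
    using Y(2) "3.prems" by (auto simp: coreset_def)
  also have "\<dots> \<le> ((1 + 1 / e) ^ L - 1) * unit_pull Y1 (\<lambda>_. True) y"
    using "3.prems" by (intro mult_right_mono diff_right_mono power_increasing unit_pull_nonneg) auto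
  finally have "\<bar>pull c A y - unit_pull Y1 A y\<bar> \<le> ((1 + 1 / e) ^ L - 1) * unit_pull Y1 (\<lambda>_. True) y" .
  moreover have "\<bar>pull (contents s) A y - unit_pull Y2 A y\<bar> \<le> ((1 + 1 / e) ^ L - 1) * unit_pull Y2 (\<lambda>_. True) y"
    using 3 Y by auto
  ultimately show ?case by (simp add: Y distrib_left)
qed auto

end

section \<open>Polynomial growth of the size bounds\<close>

definition poly_bounded :: "(nat \<Rightarrow> nat) \<Rightarrow> bool" where
  "poly_bounded f \<longleftrightarrow> (\<exists>C k. \<forall>n\<ge>1. f n \<le> C * n ^ k)"

named_theorems poly_bounded_intros

lemma poly_bounded_const [poly_bounded_intros]: "poly_bounded (\<lambda>n. c)"
  unfolding poly_bounded_def by (intro exI[of _ c] exI[of _ 0]) auto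

lemma poly_bounded_ident [poly_bounded_intros]: "poly_bounded (\<lambda>n. n)"
  unfolding poly_bounded_def by (intro exI[of _ 1]) auto

lemma poly_bounded_add [poly_bounded_intros]:
  assumes "poly_bounded f" "poly_bounded g"
  shows "poly_bounded (\<lambda>n. f n + g n)"
proof -
  obtain C k D l where *: "\<And>n. n \<ge> 1 \<Longrightarrow> f n \<le> C * n ^ k" "\<And>n. n \<ge> 1 \<Longrightarrow> g n \<le> D * n ^ l"
    using assms unfolding poly_bounded_def by blast
  have "f n + g n \<le> (C + D) * n ^ (k + l)" if "n \<ge> 1" for n
  proof -
    have "n ^ k \<le> n ^ (k + l)" "n ^ l \<le> n ^ (k + l)" using that by (auto intro: power_increasing)
    then have "C * n ^ k + D * n ^ l \<le> (C + D) * n ^ (k + l)"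
      unfolding distrib_right by (intro add_mono mult_left_mono) auto
    then show ?thesis using *[OF that] by linarith
  qed
  then show ?thesis unfolding poly_bounded_def by blast
qed

lemma poly_bounded_mult [poly_bounded_intros]:
  assumes "poly_bounded f" "poly_bounded g"
  shows "poly_bounded (\<lambda>n. f n * g n)"
proof -
  obtain C k D l where *: "\<And>n. n \<ge> 1 \<Longrightarrow> f n \<le> C * n ^ k" "\<And>n. n \<ge> 1 \<Longrightarrow> g n \<le> D * n ^ l"
    using assms unfolding poly_bounded_def by blast
  have "f n * g n \<le> (C * D) * n ^ (k + l)" if "n \<ge> 1" for n
    using mult_mono[OF *[OF that]] by (simp add: power_add algebra_simps)
  then show ?thesis unfolding poly_bounded_def by blast
qed

text \<open>Bits for \<open>L\<close> slots; the option of an empty slot gives the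
  \<open>+ 1\<close> next to \<open>(E + b + 1) * m\<close>. The exponent \<open>q\<close> covers
  both sides of every cut of the class and the full set, at most
  \<open>2 ^ (cut_class_bits E + 2)\<close> sets, times at most \<open>2 ^ E\<close> points.\<close>

definition summary_bits :: "nat \<Rightarrow> nat" where
  "summary_bits E = (let q = cut_class_bits E + E + 2; e = 24 * E\<^sup>2; m = 196 * (q + 1) * e\<^sup>2;
     N = 7 * e * m; L = E + 1; b = (2 + N) * L + 1 in ((E + b + 1) * m + 1) * L)"

lemma poly_bounded_summary_bits: "poly_bounded summary_bits"
proof -
  have "poly_bounded cut_class_bits"
    unfolding cut_class_bits_def[abs_def] Let_def power2_eq_square by (intro poly_bounded_intros)
  then show ?thesis
    unfolding summary_bits_def[abs_def] Let_def power2_eq_square by (intro poly_bounded_intros)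
qed

section \<open>Evaluating cuts on the summary\<close>

context finite_metric
begin

definition weighted_uncut :: "('a \<times> real) list \<Rightarrow> ('a \<Rightarrow> bool) \<Rightarrow> real" where
  "weighted_uncut c h = (\<Sum>(y, v)\<leftarrow>c. v * pull c (\<lambda>x. h x = h y) y)"

lemma total_nonneg: "0 \<le> total X"
  unfolding total_def by (intro sum_nonneg dist_nonneg)

text \<open>The weighted list replaces \<open>X\<close> in one argument at a time, with
  \<open>mid\<close> in between. The first replacement costs \<epsilon> times
  \<open>total X\<close>. The second is weighted by the list, whose total pull is at most twice the
  true one, and costs at most twice as much.\<close>

lemma weighted_uncut_approx:
  assumes X: "X \<subseteq> G" and c: "\<forall>(x, v)\<in>set c. x \<in> G \<and> 0 \<le> v" and \<epsilon>: "0 \<le> \<epsilon>" "\<epsilon> \<le> 1"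
    and ap: "\<And>A y. A \<in> {\<lambda>_. True, \<lambda>x. h x = True, \<lambda>x. h x = False} \<Longrightarrow> y \<in> G \<Longrightarrow>
      \<bar>pull c A y - (\<Sum>x\<in>X. if A x then \<delta> x y else 0)\<bar> \<le> \<epsilon> * (\<Sum>x\<in>X. \<delta> x y)"
  shows "\<bar>weighted_uncut c h - uncut X h\<bar> \<le> 3 * \<epsilon> * total X"
proof -
  define F where "F y = (\<Sum>x\<in>X. \<delta> x y)" for y
  define V where "V y = (\<Sum>x\<in>X. if h x = h y then \<delta> x y else 0)" for y
  define mid where "mid = (\<Sum>y\<in>X. pull c (\<lambda>x. h x = h y) y)"
  have tot: "total X = (\<Sum>y\<in>X. F y)" unfolding total_def F_def by (rule sum.swap)
  have unc: "uncut X h = (\<Sum>y\<in>X. V y)" unfolding uncut_def V_def by (rule sum.swap)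
  have apV: "\<bar>pull c (\<lambda>x. h x = h y) y - V y\<bar> \<le> \<epsilon> * F y" if "y \<in> G" for y
    using ap[OF _ that, of "\<lambda>x. h x = h y"] unfolding V_def F_def by (cases "h y") auto
  have "\<bar>mid - uncut X h\<bar> = \<bar>\<Sum>y\<in>X. pull c (\<lambda>x. h x = h y) y - V y\<bar>"
    unfolding mid_def unc by (simp add: sum_subtractf)
  also have "\<dots> \<le> (\<Sum>y\<in>X. \<epsilon> * F y)" using apV X by (intro sum_abs[THEN order_trans] sum_mono) auto
  finally have 1: "\<bar>mid - uncut X h\<bar> \<le> \<epsilon> * total X" by (simp add: tot sum_distrib_left)
  have swap: "(\<Sum>y\<in>X. pull c' (\<lambda>x. P x y) y) = (\<Sum>(x, v)\<leftarrow>c'. v * (\<Sum>y\<in>X. if P x y then \<delta> y x else 0))" for P c'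
    unfolding pull_def sum_list_sum_swap[symmetric]
    by (intro arg_cong[of _ _ sum_list] map_cong refl)
      (auto simp: sum_distrib_left dist_sym intro!: sum.cong)
  have "mid = (\<Sum>(x, v)\<leftarrow>c. v * V x)"
    unfolding mid_def swap V_def by (simp add: eq_commute)
  then have "weighted_uncut c h - mid = (\<Sum>(x, v)\<leftarrow>c. v * (pull c (\<lambda>x'. h x' = h x) x - V x))"
    unfolding weighted_uncut_def by (simp add: sum_list_subtractf[symmetric] right_diff_distrib case_prod_unfold)
  also have "\<bar>\<dots>\<bar> \<le> (\<Sum>(x, v)\<leftarrow>c. v * (\<epsilon> * F x))"
  proof -
    have *: "\<bar>\<Sum>a\<leftarrow>c. f a\<bar> \<le> (\<Sum>a\<leftarrow>c. g a)" if "\<And>a. a \<in> set c \<Longrightarrow> \<bar>f a\<bar> \<le> g a" for f g :: "'a \<times> real \<Rightarrow> real"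
      using that by (induction c) (auto intro: order_trans[OF abs_triangle_ineq] add_mono)
    show ?thesis
    proof (rule *)
      fix a assume a: "a \<in> set c"
      obtain x v where xv: "a = (x, v)" by (cases a)
      have "x \<in> G" "0 \<le> v" using bspec[OF c a] by (auto simp: xv)
      then show "\<bar>case a of (x, v) \<Rightarrow> v * (pull c (\<lambda>x'. h x' = h x) x - V x)\<bar> \<le> (case a of (x, v) \<Rightarrow> v * (\<epsilon> * F x))"
        using apV[of x] by (simp add: xv abs_mult mult_left_mono)
    qed
  qed
  also have "\<dots> = \<epsilon> * (\<Sum>(x, v)\<leftarrow>c. v * (\<Sum>y\<in>X. if True then \<delta> y x else 0))"
    unfolding sum_list_const_mult[symmetric] F_def by (simp add: case_prod_unfold mult.left_commute)
  also have "\<dots> = \<epsilon> * (\<Sum>y\<in>X. pull c (\<lambda>_. True) y)" unfolding swap[symmetric] ..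
  also have "\<dots> \<le> \<epsilon> * (\<Sum>y\<in>X. 2 * F y)"
  proof (intro mult_left_mono sum_mono)
    fix y assume "y \<in> X"
    then have "\<bar>pull c (\<lambda>_. True) y - F y\<bar> \<le> \<epsilon> * F y" using ap[of "\<lambda>_. True" y] X by (auto simp: F_def)
    moreover have "0 \<le> F y" unfolding F_def by (intro sum_nonneg dist_nonneg)
    then have "\<epsilon> * F y \<le> F y" using mult_right_mono[OF \<epsilon>(2)] by simp
    ultimately show "pull c (\<lambda>_. True) y \<le> 2 * F y" by linarith
  qed (use \<epsilon> in auto)
  finally have "\<bar>weighted_uncut c h - mid\<bar> \<le> \<epsilon> * (2 * total X)" by (simp add: tot sum_distrib_left)
  then show ?thesis using 1 by (simp add: algebra_simps)
qed

text \<open>The state is the binary counter, the answer the cheapest cut of the class on its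
  contents. Restricting to the class loses \<open>1 / E\<close> of the total. Comparing estimated
  costs loses at most twice \<open>3 * \<epsilon>\<close>, another \<open>1 / E\<close>, as
  \<epsilon> is at most \<open>1 / (6 * E)\<close>.\<close>

lemma exists_summary:
  assumes E: "1 \<le> E" "card G \<le> 2 ^ E"
  shows "\<exists>(S :: 'a slots set) s\<^sub>0 add ans. finite S \<and> card S \<le> 2 ^ summary_bits E \<and>
    (\<forall>xs. distinct xs \<and> set xs \<subseteq> G \<longrightarrow> fold add xs s\<^sub>0 \<in> S \<and>
      (\<forall>z. uncut (set xs) (ans (fold add xs s\<^sub>0)) \<le> uncut (set xs) z + 2 / E * total (set xs)))"
proof -
  obtain H where H: "finite H" "card H \<le> 2 ^ cut_class_bits E"
    and near: "\<forall>X\<subseteq>G. \<forall>z. \<exists>h\<in>H. uncut X h \<le> uncut X z + total X / E"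
    using exists_cut_class[OF E] by (elim exE conjE)
  have Hne: "H \<noteq> {}" using near[rule_format, of "{}"] by auto
  define \<A> where "\<A> = insert (\<lambda>_. True) ((\<lambda>(h, b) x. h x = b) ` (H \<times> (UNIV :: bool set)))"
  define q where "q = cut_class_bits E + E + 2"
  \<comment> \<open>Errors accumulate over \<open>E + 1\<close> levels; the quadratic accuracy makes
    \<open>L / e\<close> at most \<open>1 / (12 * E)\<close>.\<close>
  define e where "e = 24 * E\<^sup>2"
  \<comment> \<open>The counter never overflows: distinct points of \<open>G\<close> number at most
    \<open>2 ^ E\<close>, which is less than \<open>2 ^ L\<close>.\<close>
  define L where "L = E + 1"
  have cA: "card \<A> * card G \<le> 2 ^ q"
  proof -
    have "card \<A> \<le> Suc (card ((\<lambda>(h, b) x. h x = b) ` (H \<times> (UNIV :: bool set))))"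
      unfolding \<A>_def by (rule card_insert_le_m1) auto
    also have "\<dots> \<le> Suc (card (H \<times> (UNIV :: bool set)))"
      using H(1) by (intro Suc_leI le_imp_less_Suc card_image_le) auto
    also have "\<dots> \<le> 2 ^ (cut_class_bits E) + 2 ^ cut_class_bits E * 2"
    proof -
      have "card (H \<times> (UNIV :: bool set)) \<le> 2 ^ cut_class_bits E * 2"
        using H(2) by (simp add: card_cartesian_product)
      moreover have "1 \<le> (2::nat) ^ cut_class_bits E" by simp
      ultimately show ?thesis by linarith
    qed
    also have "\<dots> \<le> 2 ^ (cut_class_bits E + 2)" by simp
    finally have "card \<A> * card G \<le> 2 ^ (cut_class_bits E + 2) * 2 ^ E" using E(2) by (intro mult_mono) auto
    then show ?thesis by (simp add: q_def power_add algebra_simps)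
  qed
  interpret merge_reduce G \<delta> \<A> q e
    using H E cA by unfold_locales (auto simp: \<A>_def e_def)
  define S where "S = {s. set s \<subseteq> insert None (Some ` sparse size_bound (1 / real refinement ^ L) ((4 * refinement) ^ L + 1)) \<and> length s = L}"
  define add where "add = (\<lambda>x. carry 0 [(x, 1)])"
  define s0 :: "'a slots" where "s0 = replicate L None"
  define ans where "ans s = arg_min_on (weighted_uncut (contents s)) H" for s
  have finS: "finite S" unfolding S_def by (intro finite_lists_length_eq finite.insertI finite_imageI finite_sparse)
  have cS: "card S \<le> 2 ^ summary_bits E"
  proof -
    define b where "b = (2 + refinement) * L + 1"
    define w where "w = (E + b + 1) * size_bound"
    have "4 * refinement \<le> 2 ^ 2 * 2 ^ refinement" using le_two_power[of refinement] by simp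
    then have "(4 * refinement) ^ L \<le> (2 ^ (2 + refinement)) ^ L"
      unfolding power_add by (intro power_mono) auto
    then have "(4 * refinement) ^ L + 1 \<le> 2 ^ ((2 + refinement) * L) + 2 ^ ((2 + refinement) * L)"
      by (intro add_mono) (simp_all only: power_mult, simp)
    then have "(4 * refinement) ^ L + 1 \<le> 2 ^ b" by (simp add: b_def)
    then have sp: "card (sparse size_bound (1 / real refinement ^ L) ((4 * refinement) ^ L + 1)) \<le> 2 ^ w"
      unfolding w_def by (intro card_sparse E)
    let ?T = "Some ` sparse size_bound (1 / real refinement ^ L) ((4 * refinement) ^ L + 1)"
    have "card (insert None ?T) \<le> Suc (card ?T)" by (rule card_insert_le_m1) auto
    also have "\<dots> \<le> 2 ^ w + 2 ^ w"
    proof -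
      have "card ?T \<le> 2 ^ w" using sp by (simp add: card_image)
      moreover have "1 \<le> (2::nat) ^ w" by simp
      ultimately show ?thesis by linarith
    qed
    finally have "card (insert None ?T) \<le> 2 ^ (w + 1)" by simp
    then have "card (insert None ?T) ^ L \<le> (2 ^ (w + 1)) ^ L" by (rule power_mono) simp
    moreover have "card S = card (insert None ?T) ^ L"
      unfolding S_def by (intro card_lists_length_eq finite.insertI finite_imageI finite_sparse)
    ultimately have "card S \<le> (2 ^ (w + 1)) ^ L" by simp
    also have "\<dots> = 2 ^ summary_bits E"
      unfolding power_mult[symmetric] summary_bits_def Let_def w_def b_def refinement_def size_bound_def
      unfolding q_def e_def L_def ..
    finally show ?thesis .
  qed
  have "fold add xs s0 \<in> S \<and>
      (\<forall>z. uncut (set xs) (ans (fold add xs s0)) \<le> uncut (set xs) z + 2 / E * total (set xs))"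
    if xs: "distinct xs" "set xs \<subseteq> G" for xs
  proof -
    define X where "X = set xs"
    define s where "s = fold add xs s0"
    define \<epsilon> where "\<epsilon> = (1 + 1 / real e) ^ L - 1"
    have "length xs \<le> card G" using distinct_card[OF xs(1)] card_mono[OF finite_points xs(2)] by simp
    then have "length xs < 2 ^ L" using E(2) by (simp add: L_def order.strict_trans1)
    then have s: "represents 0 s (mset xs)" "length s = L"
      using represents_fold_carry[OF xs(2)] unfolding s_def add_def s0_def by auto
    have "s \<in> S" using represents_slots[OF s(1)] s(2) by (simp add: S_def)
    have up: "unit_pull (mset xs) A y = (\<Sum>x\<in>X. if A x then \<delta> x y else 0)" for A y
      using xs(1) unfolding unit_pull_def X_def by (simp add: sum_unfold_sum_mset mset_set_set)
    have eps: "0 \<le> \<epsilon>" "\<epsilon> \<le> 1 / (6 * E)"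
    proof -
      show "0 \<le> \<epsilon>" by (simp add: \<epsilon>_def)
      have "(1 + 1 / real e) ^ L \<le> exp (1 / e) ^ L" by (intro power_mono) auto
      also have "\<dots> = exp (L / e)" by (simp add: exp_of_nat_mult[symmetric])
      also have "\<dots> \<le> exp (1 / (12 * real E))"
        using E(1) by (simp add: L_def e_def field_simps power2_eq_square)
      also have "\<dots> \<le> 1 + 1 / (12 * real E) + (1 / (12 * real E))\<^sup>2"
        using E(1) by (intro exp_bound) auto
      finally have "\<epsilon> \<le> 1 / (12 * real E) + (1 / (12 * real E))\<^sup>2" by (simp add: \<epsilon>_def)
      moreover have "(1 / (12 * real E))\<^sup>2 \<le> 1 / (12 * real E)"
        unfolding power2_eq_square using E(1) by (intro mult_left_le) auto
      ultimately show "\<epsilon> \<le> 1 / (6 * E)" by simp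
    qed
    have close: "\<bar>weighted_uncut (contents s) h - uncut X h\<bar> \<le> 3 * \<epsilon> * total X" if h: "h \<in> H" for h
    proof (rule weighted_uncut_approx)
      have "1 / (6 * real E) \<le> 1" using E(1) by simp
      then show "\<epsilon> \<le> 1" using eps(2) by simp
      fix A y assume A: "A \<in> {\<lambda>_. True, \<lambda>x. h x = True, \<lambda>x. h x = False}" and y: "y \<in> G"
      have "(\<lambda>x. h x = b) \<in> \<A>" for b unfolding \<A>_def using h by (intro insertI2 image_eqI[of _ _ "(h, b)"]) auto
      then have "A \<in> \<A>" using A True_family by blast
      from represents_pull[OF s(1) _ this y, of L] s(2)
      show "\<bar>pull (contents s) A y - (\<Sum>x\<in>X. if A x then \<delta> x y else 0)\<bar> \<le> \<epsilon> * (\<Sum>x\<in>X. \<delta> x y)"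
        by (simp add: up \<epsilon>_def)
    qed (use represents_contents[OF s(1)] xs eps in \<open>auto simp: X_def\<close>)
    have min: "ans s \<in> H" "\<And>h. h \<in> H \<Longrightarrow> weighted_uncut (contents s) (ans s) \<le> weighted_uncut (contents s) h"
      using arg_min_if_finite[OF H(1) Hne, of "weighted_uncut (contents s)"] by (auto simp: ans_def not_less[symmetric])
    have "uncut X (ans s) \<le> uncut X z + 2 / E * total X" for z
    proof -
      obtain h where h: "h \<in> H" "uncut X h \<le> uncut X z + total X / E" using near xs(2) unfolding X_def by blast
      have "uncut X (ans s) \<le> uncut X z + total X / E + 6 * (\<epsilon> * total X)"
        using close[OF h(1)] close[OF min(1)] min(2)[OF h(1)] h(2) by linarith
      also have "6 * (\<epsilon> * total X) \<le> 6 * (1 / (6 * E) * total X)"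
        using eps total_nonneg by (intro mult_left_mono mult_right_mono) auto
      finally show ?thesis by simp
    qed
    then show ?thesis using \<open>s \<in> S\<close> unfolding X_def s_def by blast
  qed
  then show ?thesis using finS cS by blast
qed

end

section \<open>The streaming algorithm\<close>

lemma powr_convex_nonneg:
  fixes p t x y :: real
  assumes "1 \<le> p" "0 \<le> t" "t \<le> 1" "0 \<le> x" "0 \<le> y"
  shows "(t * x + (1 - t) * y) powr p \<le> t * x powr p + (1 - t) * y powr p"
proof -
  have shrink: "(r * w) powr p \<le> r * w powr p" if "0 \<le> r" "r \<le> 1" "0 \<le> w" for r w :: real
  proof -
    have "r powr p \<le> r powr 1" using that assms(1) powr_mono'[of 1 p r] by simp
    then show ?thesis using that by (simp add: powr_mult mult_right_mono)
  qed
  \<comment> \<open>Convexity is applied to positive arguments; on the boundary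
    \<open>shrink\<close> gives the claim, since the power of a factor in the unit interval does not
    exceed the factor.\<close>
  consider "x = 0" | "y = 0" | "0 < x" "0 < y" using assms by linarith
  then show ?thesis
  proof cases
    case 3
    then show ?thesis
      using convex_onD[OF powr_convex[OF assms(1)], of t y x] assms by (simp add: add.commute)
  qed (use shrink[of "1 - t" y] shrink[of t x] assms in auto)
qed

lemma lp_norm_nonneg: "0 \<le> lp_norm p d v"
  by (simp add: lp_norm_def)

lemma lp_norm_powr: "1 \<le> p \<Longrightarrow> lp_norm p d v powr p = (\<Sum>k<d. \<bar>v k\<bar> powr p)"
  by (simp add: lp_norm_def powr_powr sum_nonneg)

lemma lp_norm_eq_0:
  assumes "1 \<le> p" "lp_norm p d v = 0" "k < d"
  shows "v k = 0"
proof -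
  have "(\<Sum>k<d. \<bar>v k\<bar> powr p) = 0" using lp_norm_powr[OF assms(1), of d v] assms(2) by simp
  then have "\<bar>v k\<bar> powr p = 0" using assms(3) by (subst (asm) sum_nonneg_eq_0_iff) auto
  then show ?thesis by simp
qed

text \<open>Minkowski's inequality by convexity: the normalised vectors \<open>u / a\<close> and
  \<open>v / b\<close> are mixed with weights proportional to \<open>a\<close> and \<open>b\<close>,
  and the mixture has norm at most \<open>1\<close>. Vectors of norm \<open>0\<close> cannot be
  normalised and are treated apart.\<close>

lemma lp_norm_triangle:
  assumes p: "1 \<le> p"
  shows "lp_norm p d (\<lambda>k. u k + v k) \<le> lp_norm p d u + lp_norm p d v"
proof -
  define a where "a = lp_norm p d u"
  define b where "b = lp_norm p d v"
  have ab: "0 \<le> a" "0 \<le> b" by (simp_all add: a_def b_def lp_norm_nonneg)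
  consider "a = 0" | "b = 0" | "0 < a" "0 < b" using ab by linarith
  then show ?thesis
  proof cases
    case 1
    then have "u k = 0" if "k < d" for k using lp_norm_eq_0[OF p _ that] unfolding a_def by blast
    then have "lp_norm p d (\<lambda>k. u k + v k) = lp_norm p d v" by (simp add: lp_norm_def)
    then show ?thesis by (simp add: lp_norm_nonneg)
  next
    case 2
    then have "v k = 0" if "k < d" for k using lp_norm_eq_0[OF p _ that] unfolding b_def by blast
    then have "lp_norm p d (\<lambda>k. u k + v k) = lp_norm p d u" by (simp add: lp_norm_def)
    then show ?thesis by (simp add: lp_norm_nonneg)
  next
    case 3
    define t where "t = a / (a + b)"
    have t: "0 \<le> t" "t \<le> 1" "1 - t = b / (a + b)" using 3 by (auto simp: t_def field_simps)
    have "\<bar>u k + v k\<bar> powr p \<le> (a + b) powr p * (t * (\<bar>u k\<bar> / a) powr p + (1 - t) * (\<bar>v k\<bar> / b) powr p)" for k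
    proof -
      have "t * (\<bar>u k\<bar> / a) + (1 - t) * (\<bar>v k\<bar> / b) = (\<bar>u k\<bar> + \<bar>v k\<bar>) / (a + b)"
        unfolding t(3) using 3 by (simp add: t_def add_divide_distrib)
      then have eq: "\<bar>u k\<bar> + \<bar>v k\<bar> = (a + b) * (t * (\<bar>u k\<bar> / a) + (1 - t) * (\<bar>v k\<bar> / b))" using 3 by simp
      have "\<bar>u k + v k\<bar> powr p \<le> (\<bar>u k\<bar> + \<bar>v k\<bar>) powr p" using p by (intro powr_mono2) auto
      also have "\<dots> = (a + b) powr p * (t * (\<bar>u k\<bar> / a) + (1 - t) * (\<bar>v k\<bar> / b)) powr p"
        unfolding eq by (rule powr_mult)
      also have "\<dots> \<le> (a + b) powr p * (t * (\<bar>u k\<bar> / a) powr p + (1 - t) * (\<bar>v k\<bar> / b) powr p)"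
        using p t 3 by (intro mult_left_mono powr_convex_nonneg) auto
      finally show ?thesis .
    qed
    then have "(\<Sum>k<d. \<bar>u k + v k\<bar> powr p)
      \<le> (\<Sum>k<d. (a + b) powr p * (t * (\<bar>u k\<bar> / a) powr p + (1 - t) * (\<bar>v k\<bar> / b) powr p))"
      by (intro sum_mono)
    also have "\<dots> = (a + b) powr p * (t * ((\<Sum>k<d. \<bar>u k\<bar> powr p) / a powr p) + (1 - t) * ((\<Sum>k<d. \<bar>v k\<bar> powr p) / b powr p))"
      using 3 by (simp add: powr_divide sum_distrib_left[symmetric] sum.distrib sum_divide_distrib[symmetric])
    also have "\<dots> = (a + b) powr p"
      unfolding lp_norm_powr[OF p, symmetric] a_def[symmetric] b_def[symmetric] using 3 by simp
    finally have "lp_norm p d (\<lambda>k. u k + v k) \<le> ((a + b) powr p) powr (1 / p)"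
      unfolding lp_norm_def using p by (intro powr_mono2) (auto intro: sum_nonneg)
    also have "\<dots> = a + b" using 3 p by (simp add: powr_powr)
    finally show ?thesis by (simp add: a_def b_def)
  qed
qed

lemma finite_metric_grid:
  assumes "1 \<le> p"
  shows "finite_metric (grid d \<Delta>) (lp_dist p d)"
proof
  show "finite (grid d \<Delta>)" by (auto simp: grid_def intro: finite_PiE)
  show "0 \<le> lp_dist p d x y" for x y by (simp add: lp_dist_def lp_norm_nonneg)
  show "lp_dist p d x x = 0" for x by (simp add: lp_dist_def lp_norm_def)
  show "lp_dist p d x y = lp_dist p d y x" for x y
    by (simp add: lp_dist_def lp_norm_def abs_minus_commute)
  show "lp_dist p d x z \<le> lp_dist p d x y + lp_dist p d y z" for x y z
    using lp_norm_triangle[OF assms, of d "\<lambda>k. real (x k) - real (y k)" "\<lambda>k. real (y k) - real (z k)"]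
    by (simp add: lp_dist_def)
qed

section \<open>Cut costs in terms of point sets\<close>

lemma card_grid: "card (grid d \<Delta>) = \<Delta> ^ d"
  by (simp add: grid_def card_PiE)

lemma sum_nth_distinct: "distinct xs \<Longrightarrow> (\<Sum>i<length xs. g (xs ! i)) = sum g (set xs)"
  by (intro sum.reindex_bij_betw bij_betw_nth) auto

text \<open>For such rows the bracket in the cost is the indicator of lying on the same side, and
  distinctness turns sums over indices into sums over the set.\<close>

lemma cut_cost_eq_uncut:
  assumes "finite_metric G (lp_dist p d)" "distinct xs"
    and z: "\<And>i. i < length xs \<Longrightarrow> z i = (if h (xs ! i) then (1, 0) else (0, 1))"
  shows "cut_cost p d xs z = 1 / 2 * finite_metric.uncut (lp_dist p d) (set xs) h"
proof -
  interpret finite_metric G "lp_dist p d" by fact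
  have "(\<Sum>i<length xs. \<Sum>j<length xs. lp_dist p d (xs ! i) (xs ! j) * real (fst (z i) * fst (z j) + snd (z i) * snd (z j)))
    = (\<Sum>i<length xs. \<Sum>j<length xs. if h (xs ! i) = h (xs ! j) then lp_dist p d (xs ! i) (xs ! j) else 0)"
    by (intro sum.cong refl) (auto simp: z)
  also have "\<dots> = uncut (set xs) h"
    unfolding uncut_def sum_nth_distinct[OF assms(2), symmetric] ..
  finally show ?thesis by (simp add: cut_cost_def)
qed

text \<open>An optimal assignment of rows becomes a predicate on points, well defined because the
  points are distinct. A comparison with all predicates therefore includes the optimum.\<close>

lemma bound_le_Min_cut_cost:
  assumes metric: "finite_metric G (lp_dist p d)" and "distinct xs"
    and le: "\<And>h. a \<le> 1 / 2 * finite_metric.uncut (lp_dist p d) (set xs) h + b"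
  shows "a \<le> Min (cut_cost p d xs ` {z \<in> cuts (length xs). \<forall>i<length xs. z i \<noteq> (0, 0)}) + b"
proof -
  let ?Z = "{z \<in> cuts (length xs). \<forall>i<length xs. z i \<noteq> (0, 0)}"
  have "finite ?Z" by (rule finite_subset[of _ "cuts (length xs)"]) (auto simp: cuts_def intro!: finite_PiE)
  moreover have "(\<lambda>i\<in>{..<length xs}. (1, 0)) \<in> ?Z" by (auto simp: cuts_def)
  ultimately have "Min (cut_cost p d xs ` ?Z) \<in> cut_cost p d xs ` ?Z" by (intro Min_in) auto
  then obtain z where z: "z \<in> ?Z" "Min (cut_cost p d xs ` ?Z) = cut_cost p d xs z" by auto
  define h where "h x \<longleftrightarrow> (\<exists>i<length xs. xs ! i = x \<and> z i = (1, 0))" for x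
  have "z i = (if h (xs ! i) then (1, 0) else (0, 1))" if i: "i < length xs" for i
  proof -
    have "h (xs ! i) \<longleftrightarrow> z i = (1, 0)"
      using i nth_eq_iff_index_eq[OF assms(2)] unfolding h_def by blast
    moreover have "z i \<in> {(1, 0), (0, 1), (0, 0)}" "z i \<noteq> (0, 0)" using z(1) i by (auto simp: cuts_def PiE_iff)
    ultimately show ?thesis by auto
  qed
  then have "cut_cost p d xs z = 1 / 2 * finite_metric.uncut (lp_dist p d) (set xs) h"
    by (intro cut_cost_eq_uncut[OF metric assms(2)])
  then show ?thesis using le[of h] z(2) by simp
qed

section \<open>Finite state machines as streaming algorithms\<close>

lemma word_bits_ge_1:
  assumes "1 \<le> n" "1 \<le> d" "1 \<le> \<Delta>" "0 < \<epsilon>" "\<epsilon> < 1"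
  shows "1 \<le> word_bits 1 n d \<Delta> \<epsilon>"
proof -
  have "1 \<le> n * d * \<Delta>" using assms by simp
  then have "1 \<le> real n * real d * real \<Delta>" by (metis of_nat_1 of_nat_le_iff of_nat_mult)
  then have "1 < real n * real d * real \<Delta> / \<epsilon>" using assms by (simp add: less_divide_eq)
  then have "0 < log 2 (real n * real d * real \<Delta> / \<epsilon>)" by simp
  then show ?thesis unfolding word_bits_def by simp linarith
qed

text \<open>An abstract state machine acts on the decoded memory and encodes the result. The oracle
  is never queried.\<close>

definition bit_stream_alg ::
  "('s \<Rightarrow> memory) \<Rightarrow> (memory \<Rightarrow> 's) \<Rightarrow> 's \<Rightarrow> (point \<Rightarrow> 's \<Rightarrow> 's) \<Rightarrow> ('s \<Rightarrow> point \<Rightarrow> bool) \<Rightarrow> stream_alg" where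
  "bit_stream_alg enc dec s\<^sub>0 add ans = \<lparr>init = enc s\<^sub>0, add_point = \<lambda>x m. Return (enc (add x (dec m))),
     assign = \<lambda>x m. Return (if ans (dec m) x then (1, 0) else (0, 1))\<rparr>"

lemma memory_after_bit_stream_alg:
  assumes "\<And>k. k < length xs \<Longrightarrow> dec (enc (fold add (take k xs) s\<^sub>0)) = fold add (take k xs) s\<^sub>0"
  shows "memory_after (bit_stream_alg enc dec s\<^sub>0 add ans) r xs = enc (fold add xs s\<^sub>0)"
  using assms
proof (induction xs rule: rev_induct)
  case Nil
  show ?case by (simp add: memory_after_def bit_stream_alg_def)
next
  case (snoc x xs)
  have "memory_after (bit_stream_alg enc dec s\<^sub>0 add ans) r xs = enc (fold add xs s\<^sub>0)"
  proof (rule snoc.IH)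
    show "dec (enc (fold add (take k xs) s\<^sub>0)) = fold add (take k xs) s\<^sub>0" if "k < length xs" for k
      using snoc.prems[of k] that by simp
  qed
  then show ?case using snoc.prems[of "length xs"]
    by (simp add: memory_after_def) (simp add: bit_stream_alg_def)
qed

text \<open>One word per bit: there are \<open>2 ^ n\<close> lists of \<open>n\<close> words from
  \<open>{0, 1}\<close>, and these words fit any word size of at least one bit.\<close>

lemma exists_bit_encoding:
  fixes S :: "'s set"
  assumes "finite S" "card S \<le> 2 ^ n"
  shows "\<exists>enc :: 's \<Rightarrow> nat list. inj_on enc S \<and> (\<forall>s\<in>S. length (enc s) = n \<and> set (enc s) \<subseteq> {0, 1})"
proof -
  let ?B = "{m :: nat list. set m \<subseteq> {0, 1} \<and> length m = n}"
  have "card S \<le> card ?B" using assms(2) by (simp add: card_lists_length_eq numeral_2_eq_2)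
  moreover have "finite ?B" by (intro finite_lists_length_eq) auto
  ultimately obtain enc where "enc ` S \<subseteq> ?B" "inj_on enc S"
    using assms(1) inj_on_iff_card_le[of S ?B] by auto
  then show ?thesis by (intro exI[of _ enc]) auto
qed

theorem theorem4p2:
  "\<exists>(P :: real poly) (c :: real). c > 0 \<and>
     (\<forall>(p :: real) (d :: nat) (\<Delta> :: nat) (\<epsilon> :: real).
        1 \<le> p \<and> p \<le> 2 \<and> 1 \<le> d \<and> 1 \<le> \<Delta> \<and> 0 < \<epsilon> \<and> \<epsilon> < 1 \<longrightarrow>
        (\<exists>A :: stream_alg. \<forall>xs :: point list.
           distinct xs \<and> set xs \<subseteq> grid d \<Delta> \<longrightarrow>
             (\<forall>r. \<forall>k\<le>length xs.
                fits_in (memory_after A r (take k xs))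
                  (poly P (real d * log 2 (real \<Delta>) / \<epsilon>))
                  (word_bits c (max 1 (length xs)) d \<Delta> \<epsilon>)) \<and>
             (\<forall>r. \<forall>k\<le>length xs. \<forall>x\<in>grid d \<Delta>.
                assigned A r (take k xs) x \<in> {(1, 0), (0, 1)}) \<and>
             (\<integral>r. cut_cost p d xs (\<lambda>i. assigned A r xs (xs ! i)) \<partial>random_oracle)
               \<le> Min (cut_cost p d xs ` {z \<in> cuts (length xs). \<forall>i<length xs. z i \<noteq> (0, 0)})
                 + \<epsilon> * (\<Sum>i<length xs. \<Sum>j<length xs. lp_dist p d (xs ! i) (xs ! j))))"
proof -
  obtain C k where bits: "\<And>n. n \<ge> 1 \<Longrightarrow> summary_bits n \<le> C * n ^ k"
    using poly_bounded_summary_bits unfolding poly_bounded_def by blast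
  \<comment> \<open>Chosen so that \<open>C * E ^ k\<close> is at most \<open>poly P t\<close> for
    the rounded parameter \<open>E \<le> 1 + t\<close>.\<close>
  define P :: "real poly" where "P = smult (real C) ([:1, 1:] ^ k)"
  have polyP: "poly P t = C * (1 + t) ^ k" for t :: real by (simp add: P_def)
  interpret ro: prob_space random_oracle by (rule prob_space_random_oracle)
  show ?thesis
  proof (intro exI[of _ P] exI[of _ 1] conjI allI impI)
    show "(0::real) < 1" by simp
  next
    fix p :: real and d \<Delta> :: nat and \<epsilon> :: real
    assume asm: "1 \<le> p \<and> p \<le> 2 \<and> 1 \<le> d \<and> 1 \<le> \<Delta> \<and> 0 < \<epsilon> \<and> \<epsilon> < 1"
    define t where "t = real d * log 2 (real \<Delta>) / \<epsilon>"
    interpret finite_metric "grid d \<Delta>" "lp_dist p d" using asm by (intro finite_metric_grid) simp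
    have t0: "0 \<le> t" using asm by (simp add: t_def)
    \<comment> \<open>The error is \<open>2 * \<epsilon>\<close> because \<open>uncut\<close> is
      twice the cost.\<close>
    have "\<exists>(S :: point slots set) s\<^sub>0 add ans n. finite S \<and> card S \<le> 2 ^ n \<and> real n \<le> poly P t \<and>
      (\<forall>xs. distinct xs \<and> set xs \<subseteq> grid d \<Delta> \<longrightarrow> fold add xs s\<^sub>0 \<in> S \<and>
        (\<forall>z. uncut (set xs) (ans (fold add xs s\<^sub>0)) \<le> uncut (set xs) z + 2 * \<epsilon> * total (set xs)))"
    \<comment> \<open>For \<Delta> = 1 the parameter \<open>t\<close> is \<open>0\<close> and cannot
      dominate \<open>1 / \<epsilon>\<close>, but the grid is a single point and the memory can stay
      empty.\<close>
    proof (cases "\<Delta> = 1")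
      case True
      then have "card (grid d \<Delta>) = 1" by (simp add: card_grid)
      then obtain g where g: "grid d \<Delta> = {g}" by (auto simp: card_1_singleton_iff)
      have "uncut X h = 0" if "X \<subseteq> grid d \<Delta>" for X h
      proof -
        have "X = {} \<or> X = {g}" using that g by auto
        then show ?thesis by (auto simp: uncut_def dist_self)
      qed
      then have "uncut (set xs) h \<le> uncut (set xs) z + 2 * \<epsilon> * total (set xs)" if "set xs \<subseteq> grid d \<Delta>" for xs h z
        using that total_nonneg[of "set xs"] asm by simp
      moreover have "fold (\<lambda>_ _. []) xs [] = ([] :: point slots)" for xs :: "point list"
        by (induction xs) auto
      moreover have "0 \<le> poly P t" unfolding polyP using t0 by simp
      ultimately show ?thesis
        by (intro exI[of _ "{[]}"] exI[of _ "[]"] exI[of _ "\<lambda>_ _. []"] exI[of _ "\<lambda>_ _. True"] exI[of _ 0]) auto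
    next
      case False
      \<comment> \<open>For \<Delta> at least \<open>2\<close>, the number
        \<open>d * log 2 \<Delta>\<close> is at least \<open>1\<close>, so \<open>E\<close>
        dominates both the logarithm of the grid size and \<open>1 / \<epsilon>\<close>.\<close>
      define E where "E = nat \<lceil>t\<rceil>"
      have Et: "t \<le> E" "real E \<le> 1 + t" using t0 unfolding E_def by linarith+
      have D1: "1 \<le> real d * log 2 (real \<Delta>)"
      proof -
        have "1 \<le> log 2 (real \<Delta>)" using False asm by simp
        then have "1 * 1 \<le> real d * log 2 (real \<Delta>)" using asm by (intro mult_mono) auto
        then show ?thesis by simp
      qed
      have "1 / \<epsilon> \<le> t" unfolding t_def using D1 asm by (intro divide_right_mono) auto
      then have inv: "1 / \<epsilon> \<le> E" using Et by simp
      have "1 < 1 / \<epsilon>" using asm by simp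
      then have E1: "1 \<le> E" using inv by linarith
      have "real d * log 2 (real \<Delta>) \<le> t" unfolding t_def using D1 asm
        by (simp add: le_divide_eq mult_left_le)
      then have "2 powr (real d * log 2 (real \<Delta>)) \<le> 2 powr real E" using Et by (intro powr_mono) auto
      moreover have "2 powr (real d * log 2 (real \<Delta>)) = real (\<Delta> ^ d)"
      proof -
        have "2 powr (real d * log 2 (real \<Delta>)) = (2 powr log 2 (real \<Delta>)) powr real d"
          by (simp only: powr_powr mult.commute)
        then show ?thesis using asm by (simp add: powr_realpow)
      qed
      ultimately have "real (\<Delta> ^ d) \<le> real (2 ^ E)" by (simp add: powr_realpow)
      then have "card (grid d \<Delta>) \<le> 2 ^ E" unfolding card_grid of_nat_le_iff .
      from exists_summary[OF E1 this] obtain S :: "point slots set" and s\<^sub>0 add ans where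
        S: "finite S" "card S \<le> 2 ^ summary_bits E" and
        sum: "\<forall>xs. distinct xs \<and> set xs \<subseteq> grid d \<Delta> \<longrightarrow> fold add xs s\<^sub>0 \<in> S \<and>
          (\<forall>z. uncut (set xs) (ans (fold add xs s\<^sub>0)) \<le> uncut (set xs) z + 2 / E * total (set xs))"
        by (elim exE conjE)
      have "real (summary_bits E) \<le> real (C * E ^ k)" using bits[OF E1] by (simp only: of_nat_le_iff)
      also have "\<dots> \<le> poly P t" unfolding polyP using Et by (auto intro!: mult_left_mono power_mono)
      finally have n: "real (summary_bits E) \<le> poly P t" .
      have eps: "2 / E * total X \<le> 2 * \<epsilon> * total X" for X
        using inv E1 asm total_nonneg[of X] by (intro mult_right_mono) (auto simp: field_simps)
      have "\<forall>xs. distinct xs \<and> set xs \<subseteq> grid d \<Delta> \<longrightarrow> fold add xs s\<^sub>0 \<in> S \<and>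
        (\<forall>z. uncut (set xs) (ans (fold add xs s\<^sub>0)) \<le> uncut (set xs) z + 2 * \<epsilon> * total (set xs))"
      proof (intro allI impI conjI)
        fix xs z assume xs: "distinct xs \<and> set xs \<subseteq> grid d \<Delta>"
        show "fold add xs s\<^sub>0 \<in> S" using sum xs by simp
        show "uncut (set xs) (ans (fold add xs s\<^sub>0)) \<le> uncut (set xs) z + 2 * \<epsilon> * total (set xs)"
          using sum[rule_format, OF xs, THEN conjunct2, rule_format, of z] eps[of "set xs"] by linarith
      qed
      with S n show ?thesis
        by (intro exI[of _ S] exI[of _ s\<^sub>0] exI[of _ add] exI[of _ ans] exI[of _ "summary_bits E"] conjI)
    qed
    then obtain S :: "point slots set" and s\<^sub>0 add ans n where S: "finite S" "card S \<le> 2 ^ n" "real n \<le> poly P t"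
      and sum: "\<forall>xs. distinct xs \<and> set xs \<subseteq> grid d \<Delta> \<longrightarrow> fold add xs s\<^sub>0 \<in> S \<and>
        (\<forall>z. uncut (set xs) (ans (fold add xs s\<^sub>0)) \<le> uncut (set xs) z + 2 * \<epsilon> * total (set xs))"
      by (elim exE conjE)
    obtain enc :: "point slots \<Rightarrow> nat list" where enc: "inj_on enc S"
      "\<forall>s\<in>S. length (enc s) = n \<and> set (enc s) \<subseteq> {0, 1}"
      using exists_bit_encoding[OF S(1,2)] by (elim exE conjE)
    define dec where "dec = inv_into S enc"
    define A where "A = bit_stream_alg enc dec s\<^sub>0 add ans"
    have dec: "dec (enc s) = s" if "s \<in> S" for s using that enc(1) by (simp add: dec_def)
    have state: "fold add xs s\<^sub>0 \<in> S" if "distinct xs" "set xs \<subseteq> grid d \<Delta>" for xs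
      using sum that by blast
    have prefix: "distinct (take k xs)" "set (take k xs) \<subseteq> grid d \<Delta>"
      if "distinct xs" "set xs \<subseteq> grid d \<Delta>" for k and xs :: "point list"
      using that set_take_subset[of k xs] by auto
    have mem: "memory_after A r xs = enc (fold add xs s\<^sub>0)" if "distinct xs" "set xs \<subseteq> grid d \<Delta>" for r xs
      unfolding A_def by (intro memory_after_bit_stream_alg dec state prefix that)
    have asg: "assigned A r xs x = (if ans (fold add xs s\<^sub>0) x then (1, 0) else (0, 1))"
      if "distinct xs" "set xs \<subseteq> grid d \<Delta>" for r xs x
      unfolding assigned_def mem[OF that] by (simp add: A_def bit_stream_alg_def dec state[OF that])
    show "\<exists>A :: stream_alg. \<forall>xs :: point list.
           distinct xs \<and> set xs \<subseteq> grid d \<Delta> \<longrightarrow>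
             (\<forall>r. \<forall>k\<le>length xs.
                fits_in (memory_after A r (take k xs))
                  (poly P (real d * log 2 (real \<Delta>) / \<epsilon>))
                  (word_bits 1 (max 1 (length xs)) d \<Delta> \<epsilon>)) \<and>
             (\<forall>r. \<forall>k\<le>length xs. \<forall>x\<in>grid d \<Delta>.
                assigned A r (take k xs) x \<in> {(1, 0), (0, 1)}) \<and>
             (\<integral>r. cut_cost p d xs (\<lambda>i. assigned A r xs (xs ! i)) \<partial>random_oracle)
               \<le> Min (cut_cost p d xs ` {z \<in> cuts (length xs). \<forall>i<length xs. z i \<noteq> (0, 0)})
                 + \<epsilon> * (\<Sum>i<length xs. \<Sum>j<length xs. lp_dist p d (xs ! i) (xs ! j))"
    proof (intro exI[of _ A] allI impI, elim conjE, intro conjI allI impI ballI)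
      fix xs :: "point list" and r k
      assume xs: "distinct xs" "set xs \<subseteq> grid d \<Delta>"
      \<comment> \<open>Words hold at least one bit, so \<open>0\<close> and \<open>1\<close> fit;
        the maximum with \<open>1\<close> covers the empty stream.\<close>
      have "(2::nat) ^ 1 \<le> 2 ^ word_bits 1 (max 1 (length xs)) d \<Delta> \<epsilon>"
        using asm by (intro power_increasing word_bits_ge_1) auto
      then show "fits_in (memory_after A r (take k xs)) (poly P (real d * log 2 (real \<Delta>) / \<epsilon>))
          (word_bits 1 (max 1 (length xs)) d \<Delta> \<epsilon>)"
        using bspec[OF enc(2) state[OF prefix[OF xs]], of k] S(3)
        unfolding fits_in_def mem[OF prefix[OF xs]] t_def by auto
    next
      fix xs :: "point list" and r k x
      assume xs: "distinct xs" "set xs \<subseteq> grid d \<Delta>"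
      show "assigned A r (take k xs) x \<in> {(1, 0), (0, 1)}" unfolding asg[OF prefix[OF xs]] by simp
    next
      fix xs :: "point list"
      assume xs: "distinct xs" "set xs \<subseteq> grid d \<Delta>"
      define h where "h = ans (fold add xs s\<^sub>0)"
      have eq: "cut_cost p d xs (\<lambda>i. assigned A r xs (xs ! i)) = 1 / 2 * uncut (set xs) h" for r
        unfolding asg[OF xs] h_def by (rule cut_cost_eq_uncut[OF finite_metric_axioms xs(1)]) simp
      \<comment> \<open>The cost is constant in the oracle, so its expectation is its value.\<close>
      have "(\<integral>r. cut_cost p d xs (\<lambda>i. assigned A r xs (xs ! i)) \<partial>random_oracle) = 1 / 2 * uncut (set xs) h"
        unfolding eq by (simp add: ro.prob_space)
      also have "\<dots> \<le> Min (cut_cost p d xs ` {z \<in> cuts (length xs). \<forall>i<length xs. z i \<noteq> (0, 0)}) + \<epsilon> * total (set xs)"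
      proof (rule bound_le_Min_cut_cost[OF finite_metric_axioms xs(1)])
        show "1 / 2 * uncut (set xs) h \<le> 1 / 2 * uncut (set xs) z + \<epsilon> * total (set xs)" for z
          using sum[rule_format, OF conjI[OF xs], THEN conjunct2, rule_format, of z] unfolding h_def by simp
      qed
      also have "total (set xs) = (\<Sum>i<length xs. \<Sum>j<length xs. lp_dist p d (xs ! i) (xs ! j))"
        unfolding total_def sum_nth_distinct[OF xs(1), symmetric] ..
      finally show "(\<integral>r. cut_cost p d xs (\<lambda>i. assigned A r xs (xs ! i)) \<partial>random_oracle)
               \<le> Min (cut_cost p d xs ` {z \<in> cuts (length xs). \<forall>i<length xs. z i \<noteq> (0, 0)})
                 + \<epsilon> * (\<Sum>i<length xs. \<Sum>j<length xs. lp_dist p d (xs ! i) (xs ! j))" .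
    qed
  qed
qed

end
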